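(* Let $X$ be a complex Banach space and let $T\in B(X)$ be an invertible operator whose spectrum is a finite set $\sigma(T)=\{\lambda_1,\lambda_2,\dots,\lambda_m\}$ with $\lambda_1,\dots,\lambda_m$ pairwise distinct. Then $\sup_{n\in\mathbb{Z}}\|T^n\|<\infty$ if and only if $|\lambda_j|=1$ for every $1\le j\le m$ and there exist projections $P_1,\dots,P_m\in B(X)$ such that $T=\sum_{j=1}^m\lambda_jP_j$ and the following (i) and (ii) hold: (i) for every $1\le j\le m$, the image $P_j(X)$ is the eigenspace $\{x\in X: Tx=\lambda_jx\}$ of $T$ corresponding to $\lambda_j$; (ii) $P_iP_j=0$ for every pair $(i,j)$ with $i\ne j$, and $I=\sum_{j=1}^mP_j$. In this case, the projections are unique in the following sense: whenever $P_1,\dots,P_m$ are projections with $T=\sum_{j=1}^m\lambda_jP_j$ satisfying (i) and (ii), $P_j$ is the Riesz projection of $T$ corresponding to $\{\lambda_j\}$ for every $1\le j\le m$. Hence, for every $1\le j\le m$, the eigenspace $P_j(X)$ and $\ker P_j$ are $T$-invariant subspaces such that $P_j(X)\oplus\ker P_j=X$.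
   Context: $B(X)$ is the algebra of all bounded complex linear operators on the complex Banach space $X$, $I$ is the identity operator on $X$, and $\sigma(T)$ is the spectrum of $T\in B(X)$. A projection is an operator $P\in B(X)$ with $P^2=P$ (no self-adjointness is required). Let $T\in B(X)$ and suppose $\sigma(T)$ is the disjoint union of two closed subsets $\sigma$ and $\tau$. The Riesz projection of $T$ corresponding to $\sigma$ is $P_\sigma=\frac{1}{2\pi i}\int_\Gamma (wI-T)^{-1}\,dw$, where $\Gamma$ is a (positively oriented) Cauchy contour in the resolvent set of $T$ around $\sigma$ separating $\sigma$ from $\tau$; it is a projection and does not depend on the choice of $\Gamma$. For an isolated point $\lambda$ of $\sigma(T)$, the Riesz projection corresponding to $\lambda$ is the one with $\sigma=\{\lambda\}$ and $\tau=\sigma(T)\setminus\{\lambda\}$; thus $\Gamma$ may be taken to be a small positively oriented circle centered at $\lambda$ such that no other point of $\sigma(T)$ lies on or inside it. *)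

theory Defs
  imports "HOL-Complex_Analysis.Complex_Analysis"
begin

text \<open>
  The libraries have real Banach spaces only.  A complex Banach space is a real one
  with a complex scalar multiplication that extends the real one and for which the norm is
  homogeneous.
\<close>

class scaleC = scaleR +
  fixes scaleC :: "complex \<Rightarrow> 'a \<Rightarrow> 'a" (infixr "*\<^sub>C" 75)
  assumes scaleR_scaleC: "r *\<^sub>R x = complex_of_real r *\<^sub>C x"

class complex_normed_vector = real_normed_vector + scaleC +
  assumes scaleC_add_right: "a *\<^sub>C (x + y) = a *\<^sub>C x + a *\<^sub>C y"
    and scaleC_add_left: "(a + b) *\<^sub>C x = a *\<^sub>C x + b *\<^sub>C x"
    and scaleC_scaleC: "a *\<^sub>C (b *\<^sub>C x) = (a * b) *\<^sub>C x"
    and norm_scaleC: "norm (a *\<^sub>C x) = cmod a * norm x"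

class complex_banach = complex_normed_vector + banach

lemma scaleC_one: "1 *\<^sub>C (x :: 'a::complex_normed_vector) = x"
  using scaleR_scaleC[of 1 x] by simp

lemma vector_space_scaleC: "vector_space ((*\<^sub>C) :: complex \<Rightarrow> 'a::complex_normed_vector \<Rightarrow> 'a)"
  by unfold_locales (simp_all add: scaleC_add_right scaleC_add_left scaleC_scaleC scaleC_one)

lemma bounded_linear_scaleC: "bounded_linear (\<lambda>x :: 'a::complex_normed_vector. c *\<^sub>C x)"
  by (rule bounded_linear_intro[where K = "cmod c"])
    (simp_all add: scaleC_add_right scaleR_scaleC scaleC_scaleC norm_scaleC mult.commute)

instantiation complex :: complex_banach
begin

definition scaleC_complex :: "complex \<Rightarrow> complex \<Rightarrow> complex"
  where "scaleC_complex a z = a * z"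

instance
  by standard (simp_all add: scaleC_complex_def scaleR_conv_of_real algebra_simps norm_mult)

end

text \<open>
  Pointwise complex scaling makes the bounded real-linear maps into a complex normed space
  with the operator norm; \<open>B(X)\<close> is the closed subalgebra of the complex-linear ones.
\<close>

instantiation blinfun :: (real_normed_vector, complex_normed_vector) complex_normed_vector
begin

lift_definition scaleC_blinfun :: "complex \<Rightarrow> ('a \<Rightarrow>\<^sub>L 'b) \<Rightarrow> ('a \<Rightarrow>\<^sub>L 'b)"
  is "\<lambda>c f x. c *\<^sub>C f x"
  by (rule bounded_linear_compose[OF bounded_linear_scaleC])

instance
proof
  fix a b :: complex and r :: real and A B :: "'a \<Rightarrow>\<^sub>L 'b"
  show "r *\<^sub>R A = complex_of_real r *\<^sub>C A"
    by transfer (simp add: scaleR_scaleC)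
  show "a *\<^sub>C (A + B) = a *\<^sub>C A + a *\<^sub>C B"
    by transfer (simp add: scaleC_add_right)
  show "(a + b) *\<^sub>C A = a *\<^sub>C A + b *\<^sub>C A"
    by transfer (simp add: scaleC_add_left)
  show "a *\<^sub>C (b *\<^sub>C A) = (a * b) *\<^sub>C A"
    by transfer (simp add: scaleC_scaleC)
  have le: "norm (c *\<^sub>C C) \<le> cmod c * norm C" for c :: complex and C :: "'a \<Rightarrow>\<^sub>L 'b"
    by (rule norm_blinfun_bound)
      (auto simp: scaleC_blinfun.rep_eq norm_scaleC mult.assoc intro!: mult_left_mono norm_blinfun)
  show "norm (a *\<^sub>C A) = cmod a * norm A"
  proof (cases "a = 0")
    case True
    then show ?thesis using le[of a A] by simp
  next
    case False
    have "inverse a *\<^sub>C (a *\<^sub>C A) = A"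
      using False by transfer (simp add: scaleC_scaleC scaleC_one)
    with le[of "inverse a" "a *\<^sub>C A"] have "norm A \<le> norm (a *\<^sub>C A) / cmod a"
      by (simp add: norm_inverse divide_inverse mult.commute)
    then have "cmod a * norm A \<le> norm (a *\<^sub>C A)"
      using False by (simp add: field_simps)
    with le[of a A] show ?thesis by simp
  qed
qed

end

definition bounded_ops :: "('a::complex_banach \<Rightarrow>\<^sub>L 'a) set"
  where "bounded_ops = {A. Vector_Spaces.linear (*\<^sub>C) (*\<^sub>C) (blinfun_apply A)}"

definition op_inverse_rel :: "('a::complex_banach \<Rightarrow>\<^sub>L 'a) \<Rightarrow> ('a \<Rightarrow>\<^sub>L 'a) \<Rightarrow> bool"
  where "op_inverse_rel A S \<longleftrightarrow>
    S \<in> bounded_ops \<and> A o\<^sub>L S = id_blinfun \<and> S o\<^sub>L A = id_blinfun"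

definition op_invertible :: "('a::complex_banach \<Rightarrow>\<^sub>L 'a) \<Rightarrow> bool"
  where "op_invertible A \<longleftrightarrow> (\<exists>S. op_inverse_rel A S)"

definition op_inverse :: "('a::complex_banach \<Rightarrow>\<^sub>L 'a) \<Rightarrow> ('a \<Rightarrow>\<^sub>L 'a)"
  where "op_inverse A = (THE S. op_inverse_rel A S)"

primrec op_power :: "('a::complex_banach \<Rightarrow>\<^sub>L 'a) \<Rightarrow> nat \<Rightarrow> ('a \<Rightarrow>\<^sub>L 'a)"
  where
    "op_power A 0 = id_blinfun"
  | "op_power A (Suc n) = A o\<^sub>L op_power A n"

definition op_power_int :: "('a::complex_banach \<Rightarrow>\<^sub>L 'a) \<Rightarrow> int \<Rightarrow> ('a \<Rightarrow>\<^sub>L 'a)"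
  where "op_power_int A n =
    (if n \<ge> 0 then op_power A (nat n) else op_power (op_inverse A) (nat (- n)))"

definition op_spectrum :: "('a::complex_banach \<Rightarrow>\<^sub>L 'a) \<Rightarrow> complex set"
  where "op_spectrum A = {w. \<not> op_invertible (w *\<^sub>C id_blinfun - A)}"

definition op_resolvent :: "('a::complex_banach \<Rightarrow>\<^sub>L 'a) \<Rightarrow> complex \<Rightarrow> ('a \<Rightarrow>\<^sub>L 'a)"
  where "op_resolvent A w = op_inverse (w *\<^sub>C id_blinfun - A)"

definition is_projection :: "('a::complex_banach \<Rightarrow>\<^sub>L 'a) \<Rightarrow> bool"
  where "is_projection P \<longleftrightarrow> P \<in> bounded_ops \<and> P o\<^sub>L P = P"

definition op_ker :: "('a::complex_banach \<Rightarrow>\<^sub>L 'a) \<Rightarrow> 'a set"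
  where "op_ker A = {x. blinfun_apply A x = 0}"

definition op_eigenspace :: "('a::complex_banach \<Rightarrow>\<^sub>L 'a) \<Rightarrow> complex \<Rightarrow> 'a set"
  where "op_eigenspace A c = {x. blinfun_apply A x = c *\<^sub>C x}"

text \<open>As usual in operator theory, subspaces of a Banach space are closed.\<close>

definition invariant_subspace :: "('a::complex_banach \<Rightarrow>\<^sub>L 'a) \<Rightarrow> 'a set \<Rightarrow> bool"
  where "invariant_subspace A M \<longleftrightarrow>
    module.subspace (*\<^sub>C) M \<and> closed M \<and> blinfun_apply A ` M \<subseteq> M"

definition is_direct_sum :: "'a::complex_banach set \<Rightarrow> 'a set \<Rightarrow> bool"
  where "is_direct_sum M N \<longleftrightarrow> {u + v | u v. u \<in> M \<and> v \<in> N} = UNIV \<and> M \<inter> N = {0}"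

text \<open>
  The integral of a vector-valued function along a path, in the form of
  \<open>has_contour_integral\<close>, and its sum over a finite set of paths.
\<close>

definition has_vector_contour_integral ::
    "(complex \<Rightarrow> 'b::complex_normed_vector) \<Rightarrow> 'b \<Rightarrow> (real \<Rightarrow> complex) \<Rightarrow> bool"
  where "has_vector_contour_integral f J \<gamma> \<longleftrightarrow>
    ((\<lambda>t. vector_derivative \<gamma> (at t within {0..1}) *\<^sub>C f (\<gamma> t)) has_integral J) {0..1}"

definition has_vector_cycle_integral ::
    "(complex \<Rightarrow> 'b::complex_normed_vector) \<Rightarrow> 'b \<Rightarrow> (real \<Rightarrow> complex) set \<Rightarrow> bool"
  where "has_vector_cycle_integral f J \<Gamma> \<longleftrightarrow>
    (\<exists>K. (\<forall>\<gamma>\<in>\<Gamma>. has_vector_contour_integral f (K \<gamma>) \<gamma>) \<and> J = (\<Sum>\<gamma>\<in>\<Gamma>. K \<gamma>))"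

text \<open>
  A Cauchy contour consists of finitely many pairwise disjoint Jordan curves that together form
  the positively oriented boundary of a bounded open set, its inner domain; the winding number
  of the contour is 1 about every point of the inner domain and 0 about all other points off
  the contour.  Curves are piecewise continuously differentiable rather than merely rectifiable.
\<close>

definition cauchy_contour :: "(real \<Rightarrow> complex) set \<Rightarrow> bool"
  where "cauchy_contour \<Gamma> \<longleftrightarrow>
    finite \<Gamma> \<and>
    (\<forall>\<gamma>\<in>\<Gamma>. valid_path \<gamma> \<and> simple_path \<gamma> \<and> pathfinish \<gamma> = pathstart \<gamma>) \<and>
    (\<forall>\<gamma>\<in>\<Gamma>. \<forall>\<delta>\<in>\<Gamma>. \<gamma> \<noteq> \<delta> \<longrightarrow> path_image \<gamma> \<inter> path_image \<delta> = {}) \<and>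
    (\<forall>z. z \<notin> (\<Union>\<gamma>\<in>\<Gamma>. path_image \<gamma>) \<longrightarrow> (\<Sum>\<gamma>\<in>\<Gamma>. winding_number \<gamma> z) \<in> {0, 1})"

definition separating_contour ::
    "('a::complex_banach \<Rightarrow>\<^sub>L 'a) \<Rightarrow> complex set \<Rightarrow> (real \<Rightarrow> complex) set \<Rightarrow> bool"
  where "separating_contour A \<sigma> \<Gamma> \<longleftrightarrow>
    cauchy_contour \<Gamma> \<and>
    (\<forall>\<gamma>\<in>\<Gamma>. path_image \<gamma> \<inter> op_spectrum A = {}) \<and>
    (\<forall>z\<in>\<sigma>. (\<Sum>\<gamma>\<in>\<Gamma>. winding_number \<gamma> z) = 1) \<and>
    (\<forall>z\<in>op_spectrum A - \<sigma>. (\<Sum>\<gamma>\<in>\<Gamma>. winding_number \<gamma> z) = 0)"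

text \<open>
  The operator \<open>P\<close> is the Riesz projection of \<open>A\<close> corresponding to \<open>\<sigma>\<close>.  Independence of the
  contour is built in: every separating contour has to give \<open>P\<close>, and there has to be one, so
  \<open>P\<close> is determined by \<open>A\<close> and \<open>\<sigma>\<close>.
\<close>

definition is_riesz_projection ::
    "('a::complex_banach \<Rightarrow>\<^sub>L 'a) \<Rightarrow> complex set \<Rightarrow> ('a \<Rightarrow>\<^sub>L 'a) \<Rightarrow> bool"
  where "is_riesz_projection A \<sigma> P \<longleftrightarrow>
    \<sigma> \<subseteq> op_spectrum A \<and> closed \<sigma> \<and> closed (op_spectrum A - \<sigma>) \<and>
    (\<exists>\<Gamma>. separating_contour A \<sigma> \<Gamma>) \<and>
    (\<forall>\<Gamma>. separating_contour A \<sigma> \<Gamma> \<longrightarrow>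
      (\<exists>J. has_vector_cycle_integral (op_resolvent A) J \<Gamma> \<and>
           P = (1 / (2 * complex_of_real pi * \<i>)) *\<^sub>C J))"

definition spectral_resolution ::
    "('a::complex_banach \<Rightarrow>\<^sub>L 'a) \<Rightarrow> nat \<Rightarrow> (nat \<Rightarrow> complex) \<Rightarrow> (nat \<Rightarrow> ('a \<Rightarrow>\<^sub>L 'a)) \<Rightarrow> bool"
  where "spectral_resolution A m lam P \<longleftrightarrow>
    (\<forall>j\<in>{1..m}. is_projection (P j)) \<and>
    A = (\<Sum>j=1..m. lam j *\<^sub>C P j) \<and>
    (\<forall>j\<in>{1..m}. range (blinfun_apply (P j)) = op_eigenspace A (lam j)) \<and>
    (\<forall>i\<in>{1..m}. \<forall>j\<in>{1..m}. i \<noteq> j \<longrightarrow> P i o\<^sub>L P j = 0) \<and>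
    id_blinfun = (\<Sum>j=1..m. P j)"

end

(*
  Let p be the product of the factors z - lam j.  The crux is p(T) = 0.  For a bounded complex
  functional phi on B(X), the function e(w) = phi (p(T) R(w)), R the resolvent, is holomorphic off
  the spectrum, and power boundedness of T and its inverse gives norm (R w) * abs (norm w - 1) <= C.
  By the maximum principle on annuli around lam j such a singularity of phi (R w) is at most a
  simple pole, which the factor T - lam j of p(T) removes.  So e extends to an entire function that
  vanishes at infinity, and e = 0 by Liouville.  As phi is arbitrary (Hahn-Banach), p(T) R(w) = 0.

  Once p(T) = 0, the operator q(T) depends only on the values of the polynomial q at the lam j, and
  the Lagrange interpolation polynomials give the projections.  Conversely a resolution yields
  R(w) as the sum of the P j / (w - lam j), from which the contour integrals are read off.
*)

theory Submission
  imports Defs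
begin

section \<open>Separation by functionals\<close>

text \<open>A minimal sublinear functional below a given one is linear, so Zorn's lemma applies to
  functionals defined on the whole space and no partial extensions are needed.\<close>

definition sublinear :: "('a::real_vector \<Rightarrow> real) \<Rightarrow> bool"
  where "sublinear q \<longleftrightarrow>
    (\<forall>x y. q (x + y) \<le> q x + q y) \<and> (\<forall>t>0. \<forall>x. q (t *\<^sub>R x) \<le> t * q x)"

lemma sublinear_add: "sublinear q \<Longrightarrow> q (x + y) \<le> q x + q y"
  by (simp add: sublinear_def)

lemma sublinear_zero:
  assumes "sublinear q"
  shows "q 0 = 0"
proof -
  have "q (t *\<^sub>R 0) \<le> t * q 0" if "t > 0" for t
    using assms that unfolding sublinear_def by blast
  from this[of 2] this[of "1/2"] show ?thesis by simp
qed

lemma sublinear_scaleR: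
  assumes "sublinear q" "t \<ge> 0"
  shows "q (t *\<^sub>R x) = t * q x"
proof (cases "t = 0")
  case False
  with assms have t: "t > 0" by simp
  have le: "q (s *\<^sub>R y) \<le> s * q y" if "s > 0" for s y
    using assms that unfolding sublinear_def by blast
  have "q x \<le> inverse t * q (t *\<^sub>R x)"
    using le[of "inverse t" "t *\<^sub>R x"] t by simp
  then have "t * q x \<le> q (t *\<^sub>R x)"
    using t by (simp add: field_simps)
  with le[OF t, of x] show ?thesis by simp
qed (simp add: sublinear_zero[OF assms(1)])

lemma sublinear_minus: "sublinear q \<Longrightarrow> - q (- x) \<le> q x"
  using sublinear_add[of q x "- x"] sublinear_zero[of q] by simp

text \<open>For sublinear \<open>q\<close> this is the largest sublinear functional below
  \<open>q\<close> whose value at \<open>- y\<close> is at most \<open>- q y\<close>. A minimal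
  \<open>q\<close> has to coincide with it for every \<open>y\<close>, and that forces
  additivity.\<close>

definition sublinear_shift :: "('a::real_vector \<Rightarrow> real) \<Rightarrow> 'a \<Rightarrow> 'a \<Rightarrow> real"
  where "sublinear_shift q y x = (INF t\<in>{0..}. q (x + t *\<^sub>R y) - t * q y)"

lemma sublinear_shift_le:
  assumes "sublinear q" "t \<ge> 0"
  shows "sublinear_shift q y x \<le> q (x + t *\<^sub>R y) - t * q y"
  unfolding sublinear_shift_def
proof (rule cINF_lower)
  \<comment> \<open>Subadditivity on \<open>s y = (x + s y) + (- x)\<close> bounds the family from
    below, so the infimum is a genuine one.\<close>
  have "- q (- x) \<le> q (x + s *\<^sub>R y) - s * q y" if "s \<ge> 0" for s
    using sublinear_add[OF assms(1), of "x + s *\<^sub>R y" "- x"] sublinear_scaleR[OF assms(1) that, of y]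
    by simp
  then show "bdd_below ((\<lambda>s. q (x + s *\<^sub>R y) - s * q y) ` {0..})"
    by (intro bdd_belowI2[where m = "- q (- x)"]) simp
qed (use assms in simp)

lemma sublinear_shift_greatest:
  assumes "\<And>t. t \<ge> 0 \<Longrightarrow> c \<le> q (x + t *\<^sub>R y) - t * q y"
  shows "c \<le> sublinear_shift q y x"
  unfolding sublinear_shift_def by (rule cINF_greatest) (use assms in auto)

text \<open>Parameters \<open>t\<close> and \<open>s\<close> chosen for the two summands merge into
  \<open>t + s\<close> for their sum; the infima over \<open>t\<close> and over \<open>s\<close> are
  then taken one after the other. For homogeneity the parameter is rescaled to
  \<open>r * t\<close>.\<close>

lemma sublinear_sublinear_shift:
  assumes q: "sublinear q"
  shows "sublinear (sublinear_shift q y)"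
  unfolding sublinear_def
proof (intro conjI allI impI)
  fix x x'
  have "sublinear_shift q y (x + x')
      \<le> (q (x + t *\<^sub>R y) - t * q y) + (q (x' + s *\<^sub>R y) - s * q y)"
    if "t \<ge> 0" "s \<ge> 0" for t s
  proof -
    have "sublinear_shift q y (x + x') \<le> q ((x + x') + (t + s) *\<^sub>R y) - (t + s) * q y"
      using q that by (intro sublinear_shift_le) auto
    also have "(x + x') + (t + s) *\<^sub>R y = (x + t *\<^sub>R y) + (x' + s *\<^sub>R y)"
      by (simp add: algebra_simps)
    finally show ?thesis
      using sublinear_add[OF q, of "x + t *\<^sub>R y" "x' + s *\<^sub>R y"] by (simp add: algebra_simps)
  qed
  then have "sublinear_shift q y (x + x') - (q (x' + s *\<^sub>R y) - s * q y) \<le> sublinear_shift q y x"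
    if "s \<ge> 0" for s
    using that by (intro sublinear_shift_greatest) (force simp: algebra_simps)
  then have "sublinear_shift q y (x + x') - sublinear_shift q y x \<le> sublinear_shift q y x'"
    by (intro sublinear_shift_greatest) (force simp: algebra_simps)
  then show "sublinear_shift q y (x + x') \<le> sublinear_shift q y x + sublinear_shift q y x'"
    by simp
next
  fix r :: real and x
  assume r: "r > 0"
  have "sublinear_shift q y (r *\<^sub>R x) / r \<le> q (x + t *\<^sub>R y) - t * q y" if t: "t \<ge> 0" for t
  proof -
    have "sublinear_shift q y (r *\<^sub>R x) \<le> q (r *\<^sub>R x + (r * t) *\<^sub>R y) - (r * t) * q y"
      using q r t by (intro sublinear_shift_le) auto
    also have "\<dots> = r * (q (x + t *\<^sub>R y) - t * q y)"
      using sublinear_scaleR[OF q, of r "x + t *\<^sub>R y"] r by (simp add: algebra_simps)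
    finally show ?thesis
      using r by (simp add: field_simps)
  qed
  then have "sublinear_shift q y (r *\<^sub>R x) / r \<le> sublinear_shift q y x"
    by (rule sublinear_shift_greatest)
  then show "sublinear_shift q y (r *\<^sub>R x) \<le> r * sublinear_shift q y x"
    using r by (simp add: field_simps)
qed

text \<open>Subadditivity is where the chain matters: given \<open>q\<close> for \<open>x\<close>
  and \<open>r\<close> for \<open>y\<close>, the smaller of the two serves both arguments at
  once.\<close>

lemma sublinear_INF_chain:
  assumes "C \<noteq> {}" and sub: "\<And>q. q \<in> C \<Longrightarrow> sublinear q"
    and chain: "\<And>q r. q \<in> C \<Longrightarrow> r \<in> C \<Longrightarrow> q \<le> r \<or> r \<le> q"
    and bdd: "\<And>x. bdd_below ((\<lambda>q. q x) ` C)"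
  shows "sublinear (\<lambda>x. INF q\<in>C. q x)"
proof -
  define u where "u = (\<lambda>x. INF q\<in>C. q x)"
  have lower: "u x \<le> q x" if "q \<in> C" for q x
    unfolding u_def using that by (intro cINF_lower bdd)
  have greatest: "c \<le> u x" if "\<And>q. q \<in> C \<Longrightarrow> c \<le> q x" for c x
    unfolding u_def using that by (intro cINF_greatest \<open>C \<noteq> {}\<close>)
  have "u (x + y) \<le> u x + u y" for x y
  proof -
    have "u (x + y) \<le> q x + r y" if "q \<in> C" "r \<in> C" for q r
      using chain[OF that]
    proof
      assume "q \<le> r"
      then show ?thesis
        using lower[of q "x + y"] sublinear_add[OF sub, of q x y] that le_funD[of q r y] by simp
    next
      assume "r \<le> q"
      then show ?thesis
        using lower[of r "x + y"] sublinear_add[OF sub, of r x y] that le_funD[of r q x] by simp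
    qed
    then have "u (x + y) - r y \<le> u x" if "r \<in> C" for r
      using that by (intro greatest) (force simp: algebra_simps)
    then have "u (x + y) - u x \<le> u y"
      by (intro greatest) (force simp: algebra_simps)
    then show ?thesis by simp
  qed
  moreover have "u (t *\<^sub>R x) \<le> t * u x" if t: "t > 0" for t x
  proof -
    have "u (t *\<^sub>R x) / t \<le> q x" if "q \<in> C" for q
      using lower[OF that, of "t *\<^sub>R x"] sublinear_scaleR[OF sub[OF that], of t x] t
      by (simp add: field_simps)
    then have "u (t *\<^sub>R x) / t \<le> u x" by (rule greatest)
    then show ?thesis using t by (simp add: field_simps)
  qed
  ultimately show ?thesis
    unfolding u_def[symmetric] sublinear_def by blast
qed

lemma ex_minimal_sublinear:
  assumes p: "sublinear p"
  obtains q where "sublinear q" "q \<le> p" "\<And>r. sublinear r \<Longrightarrow> r \<le> q \<Longrightarrow> r = q"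
proof -
  define A where "A = {q. sublinear q \<and> q \<le> p}"
  have "\<exists>m\<in>A. \<forall>a\<in>A. a \<le> m \<longrightarrow> a = m"
  \<comment> \<open>The order is reversed, so that Zorn's lemma yields a minimal element and chains
    need lower bounds.\<close>
  proof (rule predicate_Zorn)
    show "partial_order_on A (relation_of (\<lambda>q r. r \<le> q) A)"
      by (rule partial_order_on_relation_ofI) auto
  next
    fix C
    assume "C \<in> Chains (relation_of (\<lambda>q r. r \<le> q) A)"
    then have CA: "C \<subseteq> A" and chain: "\<And>q r. q \<in> C \<Longrightarrow> r \<in> C \<Longrightarrow> q \<le> r \<or> r \<le> q"
      unfolding Chains_def relation_of_def by blast+
    show "\<exists>u\<in>A. \<forall>a\<in>C. u \<le> a"
    proof (cases "C = {}")
      case True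
      then show ?thesis using p by (auto simp: A_def)
    next
      case False
      \<comment> \<open>All members lie below \<open>p\<close>, hence
        \<open>- p (- x) \<le> - q (- x) \<le> q x\<close>.\<close>
      have bdd: "bdd_below ((\<lambda>q. q x) ` C)" for x
      proof (rule bdd_belowI2[where m = "- p (- x)"])
        fix q assume "q \<in> C"
        with CA have "sublinear q" "q (- x) \<le> p (- x)"
          by (auto simp: A_def le_fun_def)
        then show "- p (- x) \<le> q x"
          using sublinear_minus[of q x] by linarith
      qed
      have "sublinear (\<lambda>x. INF q\<in>C. q x)"
        using False CA chain bdd by (intro sublinear_INF_chain) (auto simp: A_def)
      moreover have lower: "(\<lambda>x. INF q\<in>C. q x) \<le> a" if "a \<in> C" for a
        using that by (auto intro!: le_funI cINF_lower bdd)
      moreover obtain a where "a \<in> C" using False by blast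
      ultimately show ?thesis
        using CA order_trans[OF lower[of a]] by (intro bexI[of _ "\<lambda>x. INF q\<in>C. q x"]) (auto simp: A_def)
    qed
  qed
  then show ?thesis
    using that order_trans unfolding A_def by blast
qed

text \<open>Each shift of \<open>q\<close> is sublinear and, by the parameter value 0, below
  \<open>q\<close>; minimality makes it equal to \<open>q\<close>. The parameter value 1 then gives
  the reverse of subadditivity.\<close>

lemma linear_minimal_sublinear:
  assumes q: "sublinear q" and min: "\<And>r. sublinear r \<Longrightarrow> r \<le> q \<Longrightarrow> r = q"
  shows "linear q"
proof -
  have "sublinear_shift q y = q" for y
  proof (rule min)
    show "sublinear_shift q y \<le> q"
      using sublinear_shift_le[OF q order_refl] by (intro le_funI) simp
  qed (rule sublinear_sublinear_shift[OF q])
  then have "q x + q y \<le> q (x + y)" for x y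
    using sublinear_shift_le[OF q zero_le_one, of y x] by simp
  with sublinear_add[OF q] have add: "q (x + y) = q x + q y" for x y
    by (simp add: order_antisym)
  have neg: "q (- x) = - q x" for x
    using add[of x "- x"] sublinear_zero[OF q] by simp
  have "q (t *\<^sub>R x) = t * q x" for t x
  proof (cases "t \<ge> 0")
    case False
    then show ?thesis
      using sublinear_scaleR[OF q, of "- t" x] neg[of "t *\<^sub>R x"] by simp
  qed (rule sublinear_scaleR[OF q])
  with add show ?thesis by (intro linearI) auto
qed

section \<open>Norming functionals, real and complex\<close>

text \<open>Take a minimal sublinear functional below the norm shifted along \<open>x\<close>. The
  shift with parameter 1 gives \<open>f (- x) \<le> norm (x - x) - norm x\<close>, which forces the
  value at \<open>x\<close>.\<close>

theorem hahn_banach_norming: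
  fixes x :: "'a::real_normed_vector"
  obtains f :: "'a \<Rightarrow> real" where "linear f" "\<And>y. f y \<le> norm y" "f x = norm x"
proof -
  have norm: "sublinear (norm :: 'a \<Rightarrow> real)"
    by (simp add: sublinear_def norm_triangle_ineq)
  obtain f where f: "sublinear f" "f \<le> sublinear_shift norm x"
    and min: "\<And>r. sublinear r \<Longrightarrow> r \<le> f \<Longrightarrow> r = f"
    using ex_minimal_sublinear[OF sublinear_sublinear_shift[OF norm]] by blast
  have lin: "linear f" using f(1) min by (rule linear_minimal_sublinear)
  have le: "f y \<le> norm y" for y
    using le_funD[OF f(2), of y] sublinear_shift_le[OF norm order_refl, of x y] by simp
  have "f (- x) \<le> - norm x"
    using le_funD[OF f(2), of "- x"] sublinear_shift_le[OF norm zero_le_one, of x "- x"] by simp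
  then have "f x = norm x"
    using le[of x] linear_neg[OF lin, of x] by simp
  with lin le that show ?thesis by blast
qed

definition complex_functional :: "('a::complex_normed_vector \<Rightarrow> complex) \<Rightarrow> bool"
  where "complex_functional \<phi> \<longleftrightarrow> bounded_linear \<phi> \<and> (\<forall>c x. \<phi> (c *\<^sub>C x) = c * \<phi> x)"

lemma complex_functional_separates_zero:
  fixes x :: "'a::complex_normed_vector"
  assumes "\<And>\<phi>. complex_functional \<phi> \<Longrightarrow> \<phi> x = 0"
  shows "x = 0"
proof -
  obtain f where f: "linear f" "\<And>y. f y \<le> norm y" "f x = norm x"
    using hahn_banach_norming by blast
  have abs: "\<bar>f y\<bar> \<le> norm y" for y
    using f(2)[of y] f(2)[of "- y"] linear_neg[OF f(1), of y] by simp
  have neg1: "(-1) *\<^sub>C y = - y" for y :: 'a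
    using scaleR_scaleC[of "-1" y] by simp
  \<comment> \<open>The usual complexification of a real functional. Its real part is
    \<open>f\<close>, so at \<open>x\<close> it has real part \<open>norm x\<close>.\<close>
  define \<phi> where "\<phi> = (\<lambda>y. Complex (f y) (- f (\<i> *\<^sub>C y)))"
  have i: "\<phi> (\<i> *\<^sub>C y) = \<i> * \<phi> y" for y
    by (simp add: \<phi>_def complex_eq_iff scaleC_scaleC neg1 linear_neg[OF f(1)])
  have add: "\<phi> (y + z) = \<phi> y + \<phi> z" for y z
    by (simp add: \<phi>_def complex_eq_iff scaleC_add_right linear_add[OF f(1)])
  have real: "\<phi> (complex_of_real r *\<^sub>C y) = complex_of_real r * \<phi> y" for r y
  proof -
    have "\<i> *\<^sub>C (complex_of_real r *\<^sub>C y) = complex_of_real r *\<^sub>C (\<i> *\<^sub>C y)"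
      by (simp add: scaleC_scaleC mult.commute)
    then show ?thesis
      by (simp add: \<phi>_def complex_eq_iff linear_cmul[OF f(1)] flip: scaleR_scaleC)
  qed
  have scale: "\<phi> (c *\<^sub>C y) = c * \<phi> y" for c y
  proof -
    have "c *\<^sub>C y = complex_of_real (Re c) *\<^sub>C y + complex_of_real (Im c) *\<^sub>C (\<i> *\<^sub>C y)"
      by (simp add: scaleC_scaleC flip: scaleC_add_left) (metis complex_eq mult.commute)
    then have "\<phi> (c *\<^sub>C y) = (complex_of_real (Re c) + complex_of_real (Im c) * \<i>) * \<phi> y"
      by (simp add: add real i algebra_simps)
    then show ?thesis
      by (metis complex_eq mult.commute)
  qed
  have "bounded_linear \<phi>"
  proof (rule bounded_linear_intro[where K = 2])
    show "\<phi> (r *\<^sub>R y) = r *\<^sub>R \<phi> y" for r y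
      using real[of r y] by (simp add: scaleR_conv_of_real flip: scaleR_scaleC)
    show "norm (\<phi> y) \<le> norm y * 2" for y
      using cmod_le[of "\<phi> y"] abs[of y] abs[of "\<i> *\<^sub>C y"] by (simp add: \<phi>_def norm_scaleC)
  qed (rule add)
  with scale have "complex_functional \<phi>"
    by (simp add: complex_functional_def)
  then have "\<phi> x = 0" by (rule assms)
  then show ?thesis
    using f(3) by (simp add: \<phi>_def complex_eq_iff)
qed

section \<open>Simple poles and removable singularities\<close>

text \<open>On \<open>\<bar>v\<bar> = \<rho>\<close> the polynomial \<open>cnj a * v\<^sup>2 + \<rho>\<^sup>2 * v + a * \<rho>\<^sup>2\<close> equals \<open>v * (\<bar>a + v\<bar>\<^sup>2 - 1)\<close>, which
  cancels the singularity of the bound on \<open>h\<close> at the two points where the circle meets the unit circle.\<close>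

lemma simple_pole_bound_circle:
  fixes h :: "complex \<Rightarrow> complex"
  assumes "r > 0" and lam: "cmod a = 1"
    and hol: "h holomorphic_on ball a r - {a}"
    and bound: "\<And>w. w \<in> ball a r - {a} \<Longrightarrow> cmod (h w) * \<bar>cmod w - 1\<bar> \<le> C"
  obtains M s where "s > 0" "\<And>w. w \<in> ball a s - {a} \<Longrightarrow> cmod ((w - a) * h w) \<le> M"
proof -
  \<comment> \<open>Half the radius keeps the closed disc of radius \<open>s\<close> inside the ball
    on which \<open>h\<close> is controlled.\<close>
  define s where "s = r / 2"
  have s: "0 < s" "s < r" using \<open>r > 0\<close> by (auto simp: s_def)
  have cont: "continuous_on (ball a r - {a}) h"
    by (rule holomorphic_on_imp_continuous_on[OF hol])
  have "compact (h ` sphere a s)"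
    by (rule compact_continuous_image[OF continuous_on_subset[OF cont]]) (use s in auto)
  then obtain M0 where "M0 > 0" and M0: "\<And>w. w \<in> sphere a s \<Longrightarrow> cmod (h w) \<le> M0"
    unfolding bounded_pos by (metis bounded_pos compact_imp_bounded imageI)
  \<comment> \<open>As \<rho> tends to 0 the weight tends to \<open>cnj a * (w - a)\<close>, whose
    modulus is that of \<open>w - a\<close>. A bound on \<open>G \<rho>\<close> that is uniform in
    \<rho> therefore bounds \<open>(w - a) * h w\<close>.\<close>
  define G where "G = (\<lambda>\<rho>::real. \<lambda>w. (cnj a * (w - a)^2 + of_real (\<rho>^2) * (w - a) + a * of_real (\<rho>^2))
      / (w - a) * h w)"
  \<comment> \<open>The two entries bound \<open>G \<rho>\<close> on the inner circle, where
    \<open>cmod z + 1 \<le> 2 + s\<close>, and on the outer circle of radius \<open>s\<close>.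
    Neither depends on \<rho>.\<close>
  define M where "M = max ((2 + s) * C) ((s^2 + s^2 * s + s^2) / s * M0)"
  have G_bound: "cmod (G \<rho> w) \<le> M" if "0 < \<rho>" "\<rho> < cmod (w - a)" "cmod (w - a) < s" for \<rho> w
  proof -
    define A where "A = ball a s - cball a \<rho>"
    show ?thesis
    proof (rule maximum_modulus_frontier[where S = A and \<xi> = w and f = "G \<rho>"])
      show "w \<in> A"
        using that by (auto simp: A_def dist_norm norm_minus_commute)
      have "open A" by (auto simp: A_def)
      have clA: "closure A \<subseteq> cball a s - ball a \<rho>"
        by (rule closure_minimal) (auto simp: A_def)
      show "G \<rho> holomorphic_on interior A"
        unfolding G_def using that s
        by (intro holomorphic_intros holomorphic_on_subset[OF hol] order_trans[OF interior_subset])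
          (auto simp: A_def dest: interior_subset[THEN subsetD])
      show "continuous_on (closure A) (G \<rho>)"
        unfolding G_def using that s clA
        by (intro continuous_intros continuous_on_subset[OF cont]) auto
      show "bounded A"
        by (auto simp: A_def intro: bounded_subset[OF bounded_ball])
      fix z
      assume "z \<in> frontier A"
      then have "z \<in> cball a s - ball a \<rho>" "z \<notin> A"
        using clA \<open>open A\<close> by (auto simp: frontier_def interior_open)
      then consider "cmod (z - a) = \<rho>" | "cmod (z - a) = s"
        by (force simp: A_def dist_norm norm_minus_commute)
      then show "cmod (G \<rho> z) \<le> M"
      proof cases
        case 1
        define v where "v = z - a"
        have v: "v \<noteq> 0" "cmod v = \<rho>" "z = a + v" using 1 that by (auto simp: v_def)
        have rho: "of_real (\<rho>^2) = v * cnj v"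
          using v by (metis complex_norm_square of_real_power)
        have ll: "a * cnj a = 1"
          using lam by (metis complex_norm_square of_real_1 one_power2)
        have "(cnj a * v^2 + of_real (\<rho>^2) * v + a * of_real (\<rho>^2)) / v = z * cnj z - 1"
          using v ll unfolding rho by (simp add: field_simps power2_eq_square)
        also have "\<dots> = of_real ((cmod z)^2 - 1)"
          using complex_norm_square[of z] by simp
        also have "(cmod z)^2 - 1 = (cmod z + 1) * (cmod z - 1)"
          by (simp add: power2_eq_square algebra_simps)
  finally have eq: "(cnj a * v^2 + of_real (\<rho>^2) * v + a * of_real (\<rho>^2)) / v
            = of_real ((cmod z + 1) * (cmod z - 1))" .
        have "cmod (G \<rho> z) = cmod (of_real ((cmod z + 1) * (cmod z - 1))) * cmod (h z)"
          unfolding G_def norm_mult eq[symmetric] v_def ..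
        also have "\<dots> = (cmod z + 1) * (cmod (h z) * \<bar>cmod z - 1\<bar>)"
          unfolding norm_of_real abs_mult by simp
        also have "\<dots> \<le> (2 + s) * C"
        proof (rule mult_mono)
          show "cmod z + 1 \<le> 2 + s"
            using norm_triangle_ineq[of a v] v that lam by simp
          show "cmod (h z) * \<bar>cmod z - 1\<bar> \<le> C"
            using 1 that s by (intro bound) (auto simp: dist_norm norm_minus_commute)
        qed (use s in auto)
        finally show ?thesis by (simp add: M_def)
      next
        case 2
        have "\<rho>^2 \<le> s^2" using that by (intro power_mono) auto
        have "cmod (cnj a * (z - a)^2 + of_real (\<rho>^2) * (z - a) + a * of_real (\<rho>^2))
            \<le> s^2 + \<rho>^2 * s + \<rho>^2"
          using norm_triangle_ineq[of "cnj a * (z - a)^2 + of_real (\<rho>^2) * (z - a)" "a * of_real (\<rho>^2)"]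
            norm_triangle_ineq[of "cnj a * (z - a)^2" "of_real (\<rho>^2) * (z - a)"] 2 lam
          by (simp add: norm_mult norm_power)
        also have "\<dots> \<le> s^2 + s^2 * s + s^2"
          using \<open>\<rho>^2 \<le> s^2\<close> s by (intro add_mono mult_right_mono) auto
        finally have num: "cmod (cnj a * (z - a)^2 + of_real (\<rho>^2) * (z - a) + a * of_real (\<rho>^2))
            \<le> s^2 + s^2 * s + s^2" .
        have "cmod (h z) \<le> M0"
          using 2 by (intro M0) (auto simp: dist_norm norm_minus_commute)
        with num have "cmod (G \<rho> z) \<le> (s^2 + s^2 * s + s^2) / s * M0"
          unfolding G_def norm_mult norm_divide 2 using s
          by (intro mult_mono divide_right_mono) auto
        then show ?thesis by (simp add: M_def)
      qed
    qed
  qed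
  show ?thesis
  proof
    show "0 < s" by fact
    fix w
    assume w: "w \<in> ball a s - {a}"
    have "((\<lambda>\<rho>. cmod (G \<rho> w)) \<longlongrightarrow> cmod (G 0 w)) (at_right 0)"
      unfolding G_def by (intro tendsto_intros) (use w in auto)
    moreover have "eventually (\<lambda>\<rho>. cmod (G \<rho> w) \<le> M) (at_right 0)"
      using w G_bound by (intro eventually_at_rightI[of 0 "cmod (w - a)"]) (auto simp: dist_norm norm_minus_commute)
    ultimately have "cmod (G 0 w) \<le> M"
      by (intro tendsto_upperbound) auto
    moreover have "cmod (G 0 w) = cmod ((w - a) * h w)"
      using w lam by (simp add: G_def norm_mult power2_eq_square)
    ultimately show "cmod ((w - a) * h w) \<le> M" by simp
  qed
qed

text \<open>Only points of the unit circle need the maximum principle. Elsewhere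
  \<open>\<bar>cmod w - 1\<bar>\<close> stays away from 0 near \<open>a\<close>, and the hypothesis
  bounds \<open>h\<close> directly.\<close>

lemma simple_pole_bound:
  fixes h :: "complex \<Rightarrow> complex"
  assumes "r > 0" and hol: "h holomorphic_on ball a r - {a}"
    and bound: "\<And>w. w \<in> ball a r - {a} \<Longrightarrow> cmod (h w) * \<bar>cmod w - 1\<bar> \<le> C"
  shows "(\<lambda>w. (w - a) * h w) \<in> O[at a](\<lambda>_. 1)"
proof -
  obtain M s where "s > 0" and M: "\<And>w. w \<in> ball a s - {a} \<Longrightarrow> cmod ((w - a) * h w) \<le> M"
  proof (cases "cmod a = 1")
    case True
    from simple_pole_bound_circle[OF \<open>r > 0\<close> True hol bound] that show ?thesis by blast
  next
    case False
    \<comment> \<open>With half the distance to the unit circle, \<open>cmod (w - a) \<le> d\<close>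
      implies \<open>d \<le> \<bar>cmod w - 1\<bar>\<close>, so the factor \<open>w - a\<close> is
      dominated by the weight in the hypothesis.\<close>
    define d where "d = \<bar>cmod a - 1\<bar> / 2"
    have "d > 0" using False by (simp add: d_def)
    show ?thesis
    proof (rule that)
      show "min r d > 0" using \<open>r > 0\<close> \<open>d > 0\<close> by simp
      fix w
      assume w: "w \<in> ball a (min r d) - {a}"
      then have "cmod (w - a) \<le> d" by (simp add: dist_norm norm_minus_commute)
      moreover have "d \<le> \<bar>cmod w - 1\<bar>"
        using norm_triangle_ineq3[of w a] calculation unfolding d_def by (simp add: abs_if split: if_splits)
      ultimately have "cmod ((w - a) * h w) \<le> \<bar>cmod w - 1\<bar> * cmod (h w)"
        unfolding norm_mult by (intro mult_right_mono) auto
      also have "\<dots> \<le> C"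
        using bound[of w] w by (simp add: mult.commute)
      finally show "cmod ((w - a) * h w) \<le> C" .
    qed
  qed
  have "eventually (\<lambda>w. cmod ((w - a) * h w) \<le> M) (at a)"
    unfolding eventually_at using \<open>s > 0\<close> M by (auto simp: dist_commute)
  then show ?thesis
    by (intro bigoI[where c = M]) simp
qed

text \<open>Boundedness near the points of \<open>S\<close> makes them removable. The entire
  extension agrees with \<open>f\<close> outside a large disc, so it too tends to 0 and vanishes by
  Liouville's theorem.\<close>

lemma holomorphic_removable_tendsto_0_imp_0:
  fixes f :: "complex \<Rightarrow> complex"
  assumes "finite S" "f holomorphic_on - S"
    and "\<And>z. z \<in> S \<Longrightarrow> f \<in> O[at z](\<lambda>_. 1)"
    and lim: "(f \<longlongrightarrow> 0) at_infinity"
    and "z \<notin> S"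
  shows "f z = 0"
proof -
  obtain g where g: "g holomorphic_on UNIV" "\<And>z. z \<notin> S \<Longrightarrow> g z = f z"
    using removable_singularities[of S UNIV f] assms by (auto simp: Compl_eq_Diff_UNIV)
  have "bounded S" using \<open>finite S\<close> by (rule finite_imp_bounded)
  then obtain b where b: "\<And>z. z \<in> S \<Longrightarrow> cmod z \<le> b"
    unfolding bounded_iff by blast
  have "eventually (\<lambda>z. f z = g z) at_infinity"
    unfolding eventually_at_infinity
  proof (intro exI allI impI)
    fix z
    assume "b + 1 \<le> cmod z"
    with b[of z] have "z \<notin> S" by linarith
    then show "f z = g z" using g by simp
  qed
  with lim have "(g \<longlongrightarrow> 0) at_infinity"
    by (rule Lim_transform_eventually)
  from Liouville_weak_0[OF g(1) this] g(2)[OF \<open>z \<notin> S\<close>] show ?thesis by simp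
qed

section \<open>Complex-linear operators and the resolvent\<close>

lemma blinfun_compose_assoc: "(A o\<^sub>L B) o\<^sub>L C = A o\<^sub>L (B o\<^sub>L C)"
  by (rule blinfun_eqI) simp

lemma id_blinfun_compose [simp]: "id_blinfun o\<^sub>L A = A" "A o\<^sub>L id_blinfun = A"
  by (auto intro: blinfun_eqI)

lemmas blinfun_compose_add_left = bounded_bilinear.add_left[OF bounded_bilinear_blinfun_compose]
  and blinfun_compose_add_right = bounded_bilinear.add_right[OF bounded_bilinear_blinfun_compose]
  and blinfun_compose_diff_left = bounded_bilinear.diff_left[OF bounded_bilinear_blinfun_compose]
  and blinfun_compose_diff_right = bounded_bilinear.diff_right[OF bounded_bilinear_blinfun_compose]
  and blinfun_compose_sum_left = bounded_bilinear.sum_left[OF bounded_bilinear_blinfun_compose]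
  and blinfun_compose_sum_right = bounded_bilinear.sum_right[OF bounded_bilinear_blinfun_compose]

lemma scaleC_zero_right [simp]: "c *\<^sub>C (0::'a::complex_normed_vector) = 0"
  using norm_scaleC[of c "0::'a"] by simp

lemma scaleC_zero_left [simp]: "0 *\<^sub>C (x::'a::complex_normed_vector) = 0"
  using norm_scaleC[of 0 x] by simp

lemma scaleC_minus_left: "(- c) *\<^sub>C (x::'a::complex_normed_vector) = - (c *\<^sub>C x)"
  using scaleC_add_left[of "- c" c x] by (simp add: eq_neg_iff_add_eq_0)

lemma scaleC_diff_left: "(a - b) *\<^sub>C (x::'a::complex_normed_vector) = a *\<^sub>C x - b *\<^sub>C x"
  using scaleC_add_left[of "a - b" b x] by (simp add: eq_diff_eq)

lemma scaleC_diff_right: "c *\<^sub>C (x - y::'a::complex_normed_vector) = c *\<^sub>C x - c *\<^sub>C y"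
  by (rule linear_diff[OF bounded_linear.linear[OF bounded_linear_scaleC]])

lemma scaleC_sum_right: "c *\<^sub>C (\<Sum>i\<in>A. f i::'a::complex_normed_vector) = (\<Sum>i\<in>A. c *\<^sub>C f i)"
  by (rule linear_sum[OF bounded_linear.linear[OF bounded_linear_scaleC]])

lemma bounded_linear_scaleC_left: "bounded_linear (\<lambda>c. c *\<^sub>C (x::'a::complex_normed_vector))"
  by (rule bounded_linear_intro[where K = "norm x"])
    (simp_all add: scaleC_add_left norm_scaleC scaleR_scaleC[where 'a = 'a] scaleC_scaleC scaleR_conv_of_real)

lemma scaleC_sum_left: "(\<Sum>i\<in>A. f i) *\<^sub>C (x::'a::complex_normed_vector) = (\<Sum>i\<in>A. f i *\<^sub>C x)"
  by (rule linear_sum[OF bounded_linear.linear[OF bounded_linear_scaleC_left]])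

lemma blinfun_apply_scaleC [simp]: "blinfun_apply (c *\<^sub>C A) x = c *\<^sub>C blinfun_apply A x"
  by (simp add: scaleC_blinfun.rep_eq)

text \<open>Additivity already belongs to the type of bounded real-linear maps; only complex
  homogeneity remains.\<close>

lemma bounded_ops_iff: "A \<in> bounded_ops \<longleftrightarrow> (\<forall>c x. blinfun_apply A (c *\<^sub>C x) = c *\<^sub>C blinfun_apply A x)"
  unfolding bounded_ops_def mem_Collect_eq linear_iff_module_hom module_hom_iff
  using vector_space_scaleC by (auto simp: blinfun.add_right linear_iff vector_space_def module_iff_vector_space)

lemma bounded_ops_scaleC: "A \<in> bounded_ops \<Longrightarrow> blinfun_apply A (c *\<^sub>C x) = c *\<^sub>C blinfun_apply A x"
  by (simp add: bounded_ops_iff)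

lemma bounded_ops_closed [intro, simp]:
  "id_blinfun \<in> bounded_ops" "0 \<in> bounded_ops"
  "A \<in> bounded_ops \<Longrightarrow> B \<in> bounded_ops \<Longrightarrow> A o\<^sub>L B \<in> bounded_ops"
  "A \<in> bounded_ops \<Longrightarrow> B \<in> bounded_ops \<Longrightarrow> A + B \<in> bounded_ops"
  "A \<in> bounded_ops \<Longrightarrow> B \<in> bounded_ops \<Longrightarrow> A - B \<in> bounded_ops"
  "A \<in> bounded_ops \<Longrightarrow> c *\<^sub>C A \<in> bounded_ops"
  by (auto simp: bounded_ops_iff blinfun.add_left blinfun.diff_left scaleC_add_right scaleC_diff_right
      scaleC_scaleC mult.commute)

lemma bounded_ops_sum [intro]: "(\<And>i. i \<in> I \<Longrightarrow> f i \<in> bounded_ops) \<Longrightarrow> sum f I \<in> bounded_ops"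
  by (induction I rule: infinite_finite_induct) auto

lemma scaleC_blinfun_compose_left: "(c *\<^sub>C A) o\<^sub>L B = c *\<^sub>C (A o\<^sub>L B)"
  by (rule blinfun_eqI) simp

text \<open>Scaling on the right has to pass through \<open>A\<close>, which is exactly complex
  homogeneity and can fail for a merely real-linear map.\<close>

lemma scaleC_blinfun_compose_right: "A \<in> bounded_ops \<Longrightarrow> A o\<^sub>L (c *\<^sub>C B) = c *\<^sub>C (A o\<^sub>L B)"
  by (rule blinfun_eqI) (simp add: bounded_ops_scaleC)

section \<open>Inverses and the resolvent\<close>

lemma op_inverse_rel_unique:
  assumes "op_inverse_rel A S" "op_inverse_rel A S'"
  shows "S = S'"
proof -
  have "S = S o\<^sub>L (A o\<^sub>L S')" using assms by (simp add: op_inverse_rel_def)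
  also have "\<dots> = (S o\<^sub>L A) o\<^sub>L S'" by (simp only: blinfun_compose_assoc)
  also have "\<dots> = S'" using assms by (simp add: op_inverse_rel_def)
  finally show ?thesis .
qed

lemma op_inverse_eqI: "op_inverse_rel A S \<Longrightarrow> op_inverse A = S"
  unfolding op_inverse_def using op_inverse_rel_unique by blast

lemma op_inverse_rel_op_inverse: "op_invertible A \<Longrightarrow> op_inverse_rel A (op_inverse A)"
  unfolding op_invertible_def using op_inverse_eqI by blast

lemma op_resolvent_rel:
  "w \<notin> op_spectrum T \<Longrightarrow> op_inverse_rel (w *\<^sub>C id_blinfun - T) (op_resolvent T w)"
  unfolding op_spectrum_def op_resolvent_def by (simp add: op_inverse_rel_op_inverse)

lemma op_resolvent_in_bounded_ops: "w \<notin> op_spectrum T \<Longrightarrow> op_resolvent T w \<in> bounded_ops"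
  using op_resolvent_rel unfolding op_inverse_rel_def by blast

lemma op_compose_resolvent:
  assumes "w \<notin> op_spectrum T"
  shows "T o\<^sub>L op_resolvent T w = w *\<^sub>C op_resolvent T w - id_blinfun"
  using op_resolvent_rel[OF assms]
  by (simp add: op_inverse_rel_def blinfun_compose_diff_left scaleC_blinfun_compose_left algebra_simps)

lemma op_resolvent_compose:
  assumes "w \<notin> op_spectrum T"
  shows "op_resolvent T w o\<^sub>L T = w *\<^sub>C op_resolvent T w - id_blinfun"
  using op_resolvent_rel[OF assms]
  by (simp add: op_inverse_rel_def blinfun_compose_diff_right
      scaleC_blinfun_compose_right[OF op_resolvent_in_bounded_ops[OF assms]] algebra_simps)

text \<open>Associate R(w) T R(v) in both ways, using R(w) T = w R(w) - I and T R(v) = v R(v) -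
  I.\<close>

lemma op_resolvent_identity:
  assumes w: "w \<notin> op_spectrum T" and v: "v \<notin> op_spectrum T"
  shows "op_resolvent T w - op_resolvent T v = (v - w) *\<^sub>C (op_resolvent T w o\<^sub>L op_resolvent T v)"
proof -
  have "op_resolvent T w o\<^sub>L (T o\<^sub>L op_resolvent T v) = (op_resolvent T w o\<^sub>L T) o\<^sub>L op_resolvent T v"
    by (simp only: blinfun_compose_assoc)
  then show ?thesis
    using op_resolvent_in_bounded_ops[OF w]
    by (simp add: op_compose_resolvent[OF v] op_resolvent_compose[OF w] blinfun_compose_diff_left
        blinfun_compose_diff_right scaleC_blinfun_compose_left scaleC_blinfun_compose_right
        scaleC_diff_left algebra_simps)
qed

text \<open>The resolvent identity first gives \<open>norm (R w) \<le> 2 * norm (R v)\<close> near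
  \<open>v\<close>, by absorbing half of \<open>norm (R w)\<close>, and then a Lipschitz estimate.
  Openness of the resolvent set will come from finiteness of the spectrum.\<close>

lemma continuous_op_resolvent:
  assumes v: "v \<notin> op_spectrum T" and op: "open (- op_spectrum T)"
  shows "(op_resolvent T \<longlongrightarrow> op_resolvent T v) (at v)"
proof -
  define K where "K = norm (op_resolvent T v)"
  have ev: "eventually (\<lambda>w. w \<notin> op_spectrum T) (at v)"
    using eventually_at_in_open'[OF op, of v] v by simp
  have "((\<lambda>w. cmod (v - w) * K) \<longlongrightarrow> cmod (v - v) * K) (at v)"
    by (intro tendsto_intros)
  then have small: "eventually (\<lambda>w. cmod (v - w) * K < 1/2) (at v)"
    by (rule order_tendstoD) simp
  have bound: "norm (op_resolvent T w - op_resolvent T v) \<le> cmod (v - w) * (2 * K * K)"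
    if "w \<notin> op_spectrum T" "cmod (v - w) * K < 1/2" for w
  proof -
    have le: "norm (op_resolvent T w - op_resolvent T v) \<le> cmod (v - w) * (norm (op_resolvent T w) * K)"
      unfolding op_resolvent_identity[OF that(1) v] norm_scaleC K_def
      by (intro mult_left_mono norm_blinfun_compose) auto
    also have "\<dots> = (cmod (v - w) * K) * norm (op_resolvent T w)" by simp
    also have "\<dots> \<le> 1/2 * norm (op_resolvent T w)"
      using that by (intro mult_right_mono) auto
    finally have "norm (op_resolvent T w) \<le> 2 * K"
      using norm_triangle_ineq2[of "op_resolvent T w" "op_resolvent T v"] by (simp add: K_def)
    then have "cmod (v - w) * (norm (op_resolvent T w) * K) \<le> cmod (v - w) * (2 * K * K)"
      by (intro mult_left_mono mult_right_mono) (auto simp: K_def)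
    with le show ?thesis by linarith
  qed
  have "((\<lambda>w. op_resolvent T w - op_resolvent T v) \<longlongrightarrow> 0) (at v)"
  proof (rule Lim_null_comparison)
    show "eventually (\<lambda>w. norm (op_resolvent T w - op_resolvent T v) \<le> cmod (v - w) * (2 * K * K)) (at v)"
      using ev small by eventually_elim (rule bound)
    have "((\<lambda>w. cmod (v - w) * (2 * K * K)) \<longlongrightarrow> cmod (v - v) * (2 * K * K)) (at v)"
      by (intro tendsto_intros)
    then show "((\<lambda>w. cmod (v - w) * (2 * K * K)) \<longlongrightarrow> 0) (at v)" by simp
  qed
  then show ?thesis by (simp add: LIM_zero_iff)
qed

text \<open>By the resolvent identity the difference quotient at \<open>v\<close> is -\<phi>(R(w)
  R(v)), which converges because the resolvent is continuous.\<close>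

lemma complex_functional_resolvent_holomorphic:
  assumes \<phi>: "complex_functional \<phi>" and op: "open (- op_spectrum T)"
  shows "(\<lambda>w. \<phi> (op_resolvent T w)) holomorphic_on - op_spectrum T"
proof -
  have lin: "bounded_linear \<phi>" and scale: "\<And>c A. \<phi> (c *\<^sub>C A) = c * \<phi> A"
    using \<phi> by (auto simp: complex_functional_def)
  have "((\<lambda>w. \<phi> (op_resolvent T w)) has_field_derivative
      - \<phi> (op_resolvent T v o\<^sub>L op_resolvent T v)) (at v)" if v: "v \<notin> op_spectrum T" for v
    unfolding has_field_derivative_iff
  proof (rule Lim_transform_eventually)
    show "((\<lambda>w. - \<phi> (op_resolvent T w o\<^sub>L op_resolvent T v)) \<longlongrightarrow>
        - \<phi> (op_resolvent T v o\<^sub>L op_resolvent T v)) (at v)"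
      by (intro tendsto_minus bounded_linear.tendsto[OF lin] continuous_op_resolvent[OF v op]
          bounded_bilinear.tendsto[OF bounded_bilinear_blinfun_compose] tendsto_const)
    have "eventually (\<lambda>w. w \<notin> op_spectrum T) (at v)"
      using eventually_at_in_open'[OF op, of v] v by simp
    then show "eventually (\<lambda>w. - \<phi> (op_resolvent T w o\<^sub>L op_resolvent T v) =
        (\<phi> (op_resolvent T w) - \<phi> (op_resolvent T v)) / (w - v)) (at v)"
      using eventually_neq_at_within[of v]
    proof eventually_elim
      case (elim w)
      have "\<phi> (op_resolvent T w) - \<phi> (op_resolvent T v) = \<phi> (op_resolvent T w - op_resolvent T v)"
        by (simp add: linear_diff[OF bounded_linear.linear[OF lin]])
      also have "\<dots> = (v - w) * \<phi> (op_resolvent T w o\<^sub>L op_resolvent T v)"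
        by (simp add: op_resolvent_identity[OF elim(1) v] scale)
      finally show ?case
        using elim(2) by (simp add: field_simps)
    qed
  qed
  then show ?thesis
    using op by (auto simp: holomorphic_on_open)
qed


section \<open>Growth of the resolvent of a power bounded operator\<close>

text \<open>Instead of summing a Neumann series, a supremum absorbs itself: w R = I + R T relates
  consecutive products of R with powers of T outside the unit circle, and with powers of the inverse
  inside it.\<close>

lemma power_bounded_resolvent_bound:
  assumes w: "w \<notin> op_spectrum T" and inv: "op_inverse_rel T S"
    and T: "\<And>n. norm (op_power T n) \<le> C" and S: "\<And>n. norm (op_power S n) \<le> C"
  shows "norm (op_resolvent T w) * \<bar>cmod w - 1\<bar> \<le> C"
proof -
  define R where "R = op_resolvent T w"
  have RT: "w *\<^sub>C R = id_blinfun + (R o\<^sub>L T)"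
    using op_resolvent_compose[OF w] by (simp add: R_def)
  have "C \<ge> 0" using order_trans[OF norm_ge_zero T] .
  \<comment> \<open>Let \<open>b\<close> be the supremum of \<open>norm (R o\<^sub>L A n)\<close>,
    finite since it is at most \<open>norm R * C\<close>. The step inequality gives
    \<open>s * b \<le> C + t * b\<close>, and \<open>norm R \<le> b\<close> by the term at
    0.\<close>
  have sup: "norm R * (s - t) \<le> C"
    if A: "\<And>n. norm (A n) \<le> C" and A0: "A 0 = id_blinfun" and "0 < s" "t < s"
      and step: "\<And>b n. (\<And>n. norm (R o\<^sub>L A n) \<le> b) \<Longrightarrow> s * norm (R o\<^sub>L A n) \<le> C + t * b"
    for A :: "nat \<Rightarrow> 'a \<Rightarrow>\<^sub>L 'a" and s t
  proof -
    have bdd: "bdd_above (range (\<lambda>n. norm (R o\<^sub>L A n)))"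
      by (rule bdd_aboveI2[where M = "norm R * C"])
        (meson A norm_blinfun_compose mult_left_mono norm_ge_zero order_trans)
    define b where "b = (SUP n. norm (R o\<^sub>L A n))"
    have le: "norm (R o\<^sub>L A n) \<le> b" for n
      unfolding b_def by (rule cSUP_upper[OF _ bdd]) simp
    have "norm (R o\<^sub>L A n) \<le> (C + t * b) / s" for n
      using step[OF le, of n] \<open>0 < s\<close> by (simp add: field_simps)
    then have "b \<le> (C + t * b) / s"
      unfolding b_def by (intro cSUP_least) auto
    then have "b * (s - t) \<le> C" using \<open>0 < s\<close> by (simp add: field_simps)
    moreover have "norm R * (s - t) \<le> b * (s - t)"
      using le[of 0] A0 \<open>t < s\<close> by (intro mult_right_mono) auto
    ultimately show ?thesis by linarith
  qed
  consider "cmod w = 1" | "cmod w > 1" | "cmod w < 1" by linarith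
  then show ?thesis
  proof cases
    case 1
    then show ?thesis using \<open>C \<ge> 0\<close> by simp
  next
    case 2
    have "norm R * (cmod w - 1) \<le> C"
    proof (rule sup[where A = "op_power T"])
      fix b n
      assume b: "\<And>n. norm (R o\<^sub>L op_power T n) \<le> b"
      have "w *\<^sub>C (R o\<^sub>L op_power T n) = op_power T n + (R o\<^sub>L op_power T (Suc n))"
        by (simp add: RT blinfun_compose_add_left blinfun_compose_assoc flip: scaleC_blinfun_compose_left)
      then show "cmod w * norm (R o\<^sub>L op_power T n) \<le> C + 1 * b"
        using norm_triangle_ineq[of "op_power T n" "R o\<^sub>L op_power T (Suc n)"] T[of n] b[of "Suc n"]
        by (simp flip: norm_scaleC)
    qed (use 2 T in auto)
    then show ?thesis using 2 by (simp add: R_def)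
  next
    case 3
    have "norm R * (1 - cmod w) \<le> C"
    proof (rule sup[where A = "op_power S"])
      fix b n
      assume b: "\<And>n. norm (R o\<^sub>L op_power S n) \<le> b"
      \<comment> \<open>Inside the unit circle the recursion runs backwards: T S = I lowers the
        power of \<open>S\<close> by one, and the factor \<open>w\<close> falls on the other
        term.\<close>
      have "w *\<^sub>C (R o\<^sub>L op_power S (Suc n)) = op_power S (Suc n) + (R o\<^sub>L ((T o\<^sub>L S) o\<^sub>L op_power S n))"
        by (simp add: RT blinfun_compose_add_left blinfun_compose_assoc flip: scaleC_blinfun_compose_left)
      then have "R o\<^sub>L op_power S n = w *\<^sub>C (R o\<^sub>L op_power S (Suc n)) - op_power S (Suc n)"
        using inv by (simp add: op_inverse_rel_def)
      then have "norm (R o\<^sub>L op_power S n) \<le> cmod w * norm (R o\<^sub>L op_power S (Suc n)) + C"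
        using norm_triangle_ineq4[of "w *\<^sub>C (R o\<^sub>L op_power S (Suc n))" "op_power S (Suc n)"] S[of "Suc n"]
        by (simp only: norm_scaleC)
      also have "\<dots> \<le> cmod w * b + C"
        by (intro add_mono mult_left_mono b) auto
      finally show "1 * norm (R o\<^sub>L op_power S n) \<le> C + cmod w * b" by simp
    qed (use 3 S in auto)
    then show ?thesis using 3 by (simp add: R_def)
  qed
qed

section \<open>Polynomials of an operator\<close>

text \<open>Horner's scheme on the coefficients, as for \<open>poly\<close>, so that induction over
  \<open>pCons\<close> yields the homomorphism rules.\<close>

definition op_poly :: "('a::complex_banach \<Rightarrow>\<^sub>L 'a) \<Rightarrow> complex poly \<Rightarrow> ('a \<Rightarrow>\<^sub>L 'a)"
  where "op_poly T p = fold_coeffs (\<lambda>a B. a *\<^sub>C id_blinfun + (T o\<^sub>L B)) p 0"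

lemma op_poly_0 [simp]: "op_poly T 0 = 0"
  by (simp add: op_poly_def)

lemma op_poly_pCons [simp]: "op_poly T (pCons a p) = a *\<^sub>C id_blinfun + (T o\<^sub>L op_poly T p)"
  by (cases "p = 0 \<and> a = 0") (auto simp: op_poly_def)

lemma op_poly_1 [simp]: "op_poly T 1 = id_blinfun"
  by (simp add: one_pCons scaleC_one)

lemma op_poly_in_bounded_ops: "T \<in> bounded_ops \<Longrightarrow> op_poly T p \<in> bounded_ops"
  by (induction p) auto

lemma op_poly_add: "op_poly T (p + q) = op_poly T p + op_poly T q"
  by (induction p q rule: poly_induct2) (simp_all add: scaleC_add_left blinfun_compose_add_right)

lemma op_poly_smult: "T \<in> bounded_ops \<Longrightarrow> op_poly T (smult c p) = c *\<^sub>C op_poly T p"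
  by (induction p) (simp_all add: scaleC_add_right scaleC_scaleC scaleC_blinfun_compose_right)

lemma op_poly_diff: "T \<in> bounded_ops \<Longrightarrow> op_poly T (p - q) = op_poly T p - op_poly T q"
  using op_poly_add[of T p "smult (- 1) q"] op_poly_smult[of T "- 1" q]
  by (simp add: scaleC_minus_left scaleC_one)

lemma op_poly_mult: "T \<in> bounded_ops \<Longrightarrow> op_poly T (p * q) = op_poly T p o\<^sub>L op_poly T q"
  by (induction p) (simp_all add: op_poly_add op_poly_smult blinfun_compose_add_left
      scaleC_blinfun_compose_left blinfun_compose_assoc)

lemma op_poly_sum: "op_poly T (\<Sum>i\<in>I. f i) = (\<Sum>i\<in>I. op_poly T (f i))"
  by (induction I rule: infinite_finite_induct) (simp_all add: op_poly_add)

lemma op_poly_eigenvector: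
  assumes "T \<in> bounded_ops" "blinfun_apply T x = c *\<^sub>C x"
  shows "blinfun_apply (op_poly T p) x = poly p c *\<^sub>C x"
  using assms by (induction p)
    (simp_all add: blinfun.add_left scaleC_add_left bounded_ops_scaleC scaleC_scaleC mult.commute)

text \<open>Split off the root \<open>a\<close>; the other points differ from \<open>a\<close>, so
  the linear factor does not vanish there and they remain roots of the quotient.\<close>

lemma prod_linear_dvd:
  fixes r :: "'a::field poly"
  assumes "finite S" "\<And>x. x \<in> S \<Longrightarrow> poly r x = 0"
  shows "(\<Prod>x\<in>S. [:- x, 1:]) dvd r"
  using assms
proof (induction S arbitrary: r rule: finite_induct)
  case (insert a S)
  then obtain q where q: "r = [:- a, 1:] * q"
    using poly_eq_0_iff_dvd[of r a] by (auto elim: dvdE)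
  have "poly q x = 0" if "x \<in> S" for x
    using insert.prems[of x] insert.hyps that by (auto simp: q)
  with insert.IH have "(\<Prod>x\<in>S. [:- x, 1:]) dvd q" by blast
  then show ?case
    using insert.hyps by (simp add: q mult_dvd_mono del: mult_pCons_left)
qed simp

section \<open>The annihilating polynomial\<close>

text \<open>Each spectral point enters with a simple factor because power boundedness leaves the
  resolvent, tested against functionals, at most simple poles.\<close>

lemma power_bounded_finite_spectrum_annihilated:
  assumes T: "T \<in> bounded_ops" and fin: "finite (op_spectrum T)" and inv: "op_inverse_rel T S"
    and pow: "\<And>n. norm (op_power T n) \<le> C" "\<And>n. norm (op_power S n) \<le> C"
  shows "op_poly T (\<Prod>x\<in>op_spectrum T. [:- x, 1:]) = 0"
proof -
  define \<sigma> where "\<sigma> = op_spectrum T"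
  define R where "R = op_resolvent T"
  define Q where "Q = op_poly T (\<Prod>x\<in>\<sigma>. [:- x, 1:])"
  have fin: "finite \<sigma>" and op: "open (- \<sigma>)"
    using fin by (auto simp: \<sigma>_def finite_imp_closed)
  have bound: "norm (R w) * \<bar>cmod w - 1\<bar> \<le> C" if "w \<notin> \<sigma>" for w
    unfolding R_def using that inv pow by (intro power_bounded_resolvent_bound) (auto simp: \<sigma>_def)
  have zero: "\<phi> (Q o\<^sub>L R w) = 0" if \<phi>: "complex_functional \<phi>" and w: "w \<notin> \<sigma>" for \<phi> w
  proof -
    \<comment> \<open>Composing with a fixed operator gives another functional, so holomorphy and
      the growth bound apply to R(w) preceded by \<open>Q\<close> as well as by the partial product
      \<open>B\<close> below.\<close>
    have compose: "complex_functional (\<lambda>A. \<phi> (B o\<^sub>L A))" if "B \<in> bounded_ops" for B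
      using \<phi> that bounded_linear_compose[OF _ bounded_bilinear.bounded_linear_right[OF
            bounded_bilinear_blinfun_compose], of \<phi> B]
      by (simp add: complex_functional_def scaleC_blinfun_compose_right)
    have holo: "(\<lambda>w. \<psi> (R w)) holomorphic_on - \<sigma>" if "complex_functional \<psi>" for \<psi>
      unfolding R_def \<sigma>_def using that op
      by (intro complex_functional_resolvent_holomorphic) (auto simp: \<sigma>_def)
    have psi_bound: "\<exists>K. \<forall>w. w \<notin> \<sigma> \<longrightarrow> cmod (\<psi> (R w)) * \<bar>cmod w - 1\<bar> \<le> K"
      if \<psi>: "complex_functional \<psi>" for \<psi>
    proof -
      from \<psi> obtain K where "K > 0" and K: "\<And>A. cmod (\<psi> A) \<le> norm A * K"
        using bounded_linear.pos_bounded unfolding complex_functional_def by blast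
      have "cmod (\<psi> (R w)) * \<bar>cmod w - 1\<bar> \<le> C * K" if "w \<notin> \<sigma>" for w
      proof -
        have "cmod (\<psi> (R w)) * \<bar>cmod w - 1\<bar> \<le> norm (R w) * K * \<bar>cmod w - 1\<bar>"
          by (intro mult_right_mono K) simp
        also have "\<dots> = (norm (R w) * \<bar>cmod w - 1\<bar>) * K" by simp
        also have "\<dots> \<le> C * K"
          using bound[OF that] \<open>K > 0\<close> by (intro mult_right_mono) auto
        finally show ?thesis .
      qed
      then show ?thesis by blast
    qed
    show ?thesis
    proof (rule holomorphic_removable_tendsto_0_imp_0[OF fin _ _ _ w])
      have Q: "complex_functional (\<lambda>A. \<phi> (Q o\<^sub>L A))"
        using T by (intro compose) (auto simp: Q_def op_poly_in_bounded_ops)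
      show "(\<lambda>w. \<phi> (Q o\<^sub>L R w)) holomorphic_on - \<sigma>"
        by (rule holo[OF Q])
      obtain K where K: "\<And>w. w \<notin> \<sigma> \<Longrightarrow> cmod (\<phi> (Q o\<^sub>L R w)) * \<bar>cmod w - 1\<bar> \<le> K"
        using psi_bound[OF Q] by blast
      obtain b where b: "\<And>z. z \<in> \<sigma> \<Longrightarrow> cmod z \<le> b"
        using finite_imp_bounded[OF fin] unfolding bounded_iff by blast
      show "((\<lambda>w. \<phi> (Q o\<^sub>L R w)) \<longlongrightarrow> 0) at_infinity"
      proof (rule Lim_null_comparison)
        \<comment> \<open>The bound that controls the poles also gives decay at infinity, since its
          weight grows like \<open>cmod w\<close>.\<close>
        show "eventually (\<lambda>w. norm (\<phi> (Q o\<^sub>L R w)) \<le> K / (cmod w - 1)) at_infinity"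
          unfolding eventually_at_infinity
        proof (intro exI allI impI)
          fix w :: complex
          assume "max 2 (b + 1) \<le> cmod w"
          then have "w \<notin> \<sigma>" "cmod w > 1" using b[of w] by auto
          then show "norm (\<phi> (Q o\<^sub>L R w)) \<le> K / (cmod w - 1)"
            using K[of w] by (simp add: field_simps)
        qed
        have "((\<lambda>x::real. K / (x - 1)) \<longlongrightarrow> 0) at_top"
          using filterlim_tendsto_add_at_top[OF tendsto_const[of "-1::real"] filterlim_ident]
          by (intro tendsto_divide_0[OF tendsto_const] filterlim_at_top_imp_at_infinity) simp
        then show "((\<lambda>w::complex. K / (cmod w - 1)) \<longlongrightarrow> 0) at_infinity"
          by (rule filterlim_compose[OF _ filterlim_norm_at_top])
      qed
    next
      fix a
      assume a: "a \<in> \<sigma>"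
      \<comment> \<open>\<open>B\<close> omits the factor at \<open>a\<close>, so Q = B (T - a I).
        From (T - a I) R(w) = (w - a) R(w) - I it follows that Q R(w) = (w - a) B R(w) - B, bounded
        near \<open>a\<close> once \<phi> is applied.\<close>
      define B where "B = op_poly T (\<Prod>x\<in>\<sigma> - {a}. [:- x, 1:])"
      have B: "B \<in> bounded_ops" using T by (simp add: B_def op_poly_in_bounded_ops)
      have "(\<Prod>x\<in>\<sigma>. [:- x, 1:]) = (\<Prod>x\<in>\<sigma> - {a}. [:- x, 1:]) * [:- a, 1:]"
        using fin a by (subst prod.remove[of _ a]) (auto simp: mult.commute)
      then have QB: "Q = B o\<^sub>L (T - a *\<^sub>C id_blinfun)"
        by (simp add: Q_def B_def op_poly_mult[OF T] scaleC_one scaleC_minus_left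
            del: mult_pCons_left mult_pCons_right)
      have B\<phi>: "complex_functional (\<lambda>A. \<phi> (B o\<^sub>L A))" by (rule compose[OF B])
      obtain K where K: "\<And>w. w \<notin> \<sigma> \<Longrightarrow> cmod (\<phi> (B o\<^sub>L R w)) * \<bar>cmod w - 1\<bar> \<le> K"
        using psi_bound[OF B\<phi>] by blast
      have "open (- (\<sigma> - {a}))" using fin by (intro open_Compl finite_imp_closed) simp
      with a obtain r where "r > 0" and "ball a r \<subseteq> - (\<sigma> - {a})"
        unfolding open_contains_ball by blast
      then have r: "ball a r - {a} \<subseteq> - \<sigma>" by blast
      have "(\<lambda>w. (w - a) * \<phi> (B o\<^sub>L R w)) \<in> O[at a](\<lambda>_. 1)"
        using \<open>r > 0\<close> r K by (intro simple_pole_bound[where C = K] holomorphic_on_subset[OF holo[OF B\<phi>]]) auto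
      moreover have "(\<lambda>w. \<phi> B) \<in> O[at a](\<lambda>_. 1)" by simp
      ultimately have "(\<lambda>w. (w - a) * \<phi> (B o\<^sub>L R w) - \<phi> B) \<in> O[at a](\<lambda>_. 1)"
        by (rule sum_in_bigo)
      moreover have "eventually (\<lambda>w. (w - a) * \<phi> (B o\<^sub>L R w) - \<phi> B = \<phi> (Q o\<^sub>L R w)) (at a)"
        unfolding eventually_at
      proof (intro exI conjI ballI impI)
        fix w
        assume "w \<noteq> a \<and> dist w a < r"
        with r have "w \<notin> op_spectrum T" by (auto simp: \<sigma>_def dist_commute)
        then have "(T - a *\<^sub>C id_blinfun) o\<^sub>L R w = (w - a) *\<^sub>C R w - id_blinfun"
          by (simp add: R_def blinfun_compose_diff_left op_compose_resolvent scaleC_blinfun_compose_left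
              scaleC_diff_left)
        then have "Q o\<^sub>L R w = (w - a) *\<^sub>C (B o\<^sub>L R w) - B"
          unfolding QB blinfun_compose_assoc
          by (simp only: blinfun_compose_diff_right[of B] scaleC_blinfun_compose_right[OF B] id_blinfun_compose)
        then show "(w - a) * \<phi> (B o\<^sub>L R w) - \<phi> B = \<phi> (Q o\<^sub>L R w)"
          using \<phi> linear_diff[OF bounded_linear.linear, of \<phi>] unfolding complex_functional_def by simp
      qed (rule \<open>r > 0\<close>)
      ultimately show "(\<lambda>w. \<phi> (Q o\<^sub>L R w)) \<in> O[at a](\<lambda>_. 1)"
        by (rule landau_o.big.in_cong[THEN iffD1, rotated])
    qed
  qed
  \<comment> \<open>One point of the resolvent set suffices: R(w) is invertible there and cancels
    from Q R(w) = 0.\<close>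
  obtain w where w: "w \<notin> \<sigma>"
    using ex_new_if_finite[OF infinite_UNIV_char_0 fin] by blast
  then have "Q o\<^sub>L R w = 0"
    by (intro complex_functional_separates_zero[OF zero])
  then have "Q o\<^sub>L (R w o\<^sub>L (w *\<^sub>C id_blinfun - T)) = 0"
    by (simp flip: blinfun_compose_assoc)
  then show ?thesis
    using op_resolvent_rel[of w T] w by (simp add: op_inverse_rel_def R_def Q_def \<sigma>_def)
qed

section \<open>Spectral resolutions\<close>

text \<open>For a resolution this is its functional calculus. Coefficients are indexed by
  \<open>j\<close> rather than by spectral points, so products, powers and inverses act
  pointwise.\<close>

definition spectral_sum :: "nat \<Rightarrow> (nat \<Rightarrow> ('a::complex_banach \<Rightarrow>\<^sub>L 'a)) \<Rightarrow> (nat \<Rightarrow> complex) \<Rightarrow> ('a \<Rightarrow>\<^sub>L 'a)"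
  where "spectral_sum m P f = (\<Sum>j=1..m. f j *\<^sub>C P j)"

text \<open>Comparing the terms rather than the coefficients leaves the coefficients free wherever
  \<open>P j = 0\<close>.\<close>

lemma spectral_sum_cong:
  "(\<And>j. j \<in> {1..m} \<Longrightarrow> f j *\<^sub>C P j = g j *\<^sub>C P j) \<Longrightarrow> spectral_sum m P f = spectral_sum m P g"
  by (simp add: spectral_sum_def)

lemma norm_spectral_sum_le:
  assumes "\<And>j. j \<in> {1..m} \<Longrightarrow> cmod (f j) \<le> 1"
  shows "norm (spectral_sum m P f) \<le> (\<Sum>j=1..m. norm (P j))"
  unfolding spectral_sum_def using assms
  by (intro sum_norm_le) (auto simp: norm_scaleC intro: mult_left_le_one_le)

context
  fixes T :: "'a::complex_banach \<Rightarrow>\<^sub>L 'a" and m lam P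
  assumes res: "spectral_resolution T m lam P"
begin

lemma resolution_projection: "j \<in> {1..m} \<Longrightarrow> P j \<in> bounded_ops" "j \<in> {1..m} \<Longrightarrow> P j o\<^sub>L P j = P j"
  using res by (auto simp: spectral_resolution_def is_projection_def)

lemma resolution_orthogonal: "i \<in> {1..m} \<Longrightarrow> j \<in> {1..m} \<Longrightarrow> P i o\<^sub>L P j = (if i = j then P j else 0)"
  using res resolution_projection by (auto simp: spectral_resolution_def)

lemma resolution_eq: "T = spectral_sum m P lam" "id_blinfun = spectral_sum m P (\<lambda>_. 1)"
  using res by (auto simp: spectral_resolution_def spectral_sum_def scaleC_one)

lemma spectral_sum_in_bounded_ops: "spectral_sum m P f \<in> bounded_ops"
  unfolding spectral_sum_def using resolution_projection by auto

lemma spectral_sum_compose_projection: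
  assumes j: "j \<in> {1..m}"
  shows "spectral_sum m P f o\<^sub>L P j = f j *\<^sub>C P j" "P j o\<^sub>L spectral_sum m P f = f j *\<^sub>C P j"
proof -
  have "spectral_sum m P f o\<^sub>L P j = (\<Sum>i=1..m. if i = j then f j *\<^sub>C P j else 0)"
    unfolding spectral_sum_def blinfun_compose_sum_left using j
    by (intro sum.cong) (auto simp: scaleC_blinfun_compose_left resolution_orthogonal)
  then show "spectral_sum m P f o\<^sub>L P j = f j *\<^sub>C P j" using j by simp
  have "P j o\<^sub>L spectral_sum m P f = (\<Sum>i=1..m. if i = j then f j *\<^sub>C P j else 0)"
    unfolding spectral_sum_def blinfun_compose_sum_right using j
    by (intro sum.cong) (auto simp: scaleC_blinfun_compose_right resolution_projection resolution_orthogonal)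
  then show "P j o\<^sub>L spectral_sum m P f = f j *\<^sub>C P j" using j by simp
qed

lemma spectral_sum_mult:
  "spectral_sum m P f o\<^sub>L spectral_sum m P g = spectral_sum m P (\<lambda>j. f j * g j)"
  unfolding spectral_sum_def[of m P g] blinfun_compose_sum_right
  by (simp add: scaleC_blinfun_compose_right[OF spectral_sum_in_bounded_ops]
      spectral_sum_compose_projection spectral_sum_def[of m P "\<lambda>j. f j * g j"] scaleC_scaleC mult.commute)

lemma op_power_spectral_sum:
  "op_power (spectral_sum m P f) n = spectral_sum m P (\<lambda>j. f j ^ n)"
  by (induction n) (simp_all add: spectral_sum_mult flip: resolution_eq(2))

text \<open>An index with \<open>P j = 0\<close> contributes nothing, so a zero coefficient there,
  with \<open>inverse 0 = 0\<close>, does no harm.\<close>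

lemma spectral_sum_inverse:
  assumes "\<And>j. j \<in> {1..m} \<Longrightarrow> f j \<noteq> 0 \<or> P j = 0"
  shows "op_inverse_rel (spectral_sum m P f) (spectral_sum m P (\<lambda>j. inverse (f j)))"
proof -
  have "spectral_sum m P (\<lambda>j. f j * inverse (f j)) = id_blinfun"
    unfolding resolution_eq(2) by (rule spectral_sum_cong) (use assms in force)
  then show ?thesis
    by (simp add: op_inverse_rel_def spectral_sum_in_bounded_ops spectral_sum_mult mult.commute)
qed

lemma resolution_shift:
  "w *\<^sub>C id_blinfun - T = spectral_sum m P (\<lambda>j. w - lam j)"
  unfolding resolution_eq
  by (simp add: spectral_sum_def scaleC_sum_right scaleC_one scaleC_diff_left sum_subtractf)

lemma resolution_resolvent:
  "w \<notin> lam ` {1..m} \<Longrightarrow> op_resolvent T w = (\<Sum>j=1..m. (1 / (w - lam j)) *\<^sub>C P j)"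
  unfolding op_resolvent_def resolution_shift
  by (subst op_inverse_eqI[OF spectral_sum_inverse]) (auto simp: spectral_sum_def inverse_eq_divide)

text \<open>By injectivity the only vanishing coefficient of
  \<open>lam j *\<^sub>C id_blinfun - T\<close> sits at \<open>j\<close>. If \<open>P j\<close> were
  zero, this operator would be invertible.\<close>

lemma resolution_spectrum_nonzero:
  assumes "inj_on lam {1..m}" "j \<in> {1..m}" "lam j \<in> op_spectrum T"
  shows "P j \<noteq> 0"
proof
  assume "P j = 0"
  then have "op_inverse_rel (lam j *\<^sub>C id_blinfun - T) (spectral_sum m P (\<lambda>i. inverse (lam j - lam i)))"
    unfolding resolution_shift using assms(1,2)
    by (intro spectral_sum_inverse) (auto dest: inj_onD)
  with assms(3) show False
    by (auto simp: op_spectrum_def op_invertible_def)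
qed

text \<open>On the range of \<open>P j\<close> the n-th power acts as multiplication by
  \<open>f j ^ n\<close>, which is unbounded in n if \<open>f j\<close> lies outside the unit
  disc.\<close>

lemma power_bounded_spectral_sum:
  assumes bound: "\<And>n. norm (op_power (spectral_sum m P f) n) \<le> C" and j: "j \<in> {1..m}" and "P j \<noteq> 0"
  shows "cmod (f j) \<le> 1"
proof (rule ccontr)
  assume "\<not> ?thesis"
  then obtain n where n: "C < cmod (f j) ^ n"
    using real_arch_pow[of "cmod (f j)" C] by auto
  have "cmod (f j) ^ n * norm (P j) = norm (op_power (spectral_sum m P f) n o\<^sub>L P j)"
    by (simp add: op_power_spectral_sum spectral_sum_compose_projection(1)[OF j] norm_scaleC norm_power)
  also have "\<dots> \<le> norm (op_power (spectral_sum m P f) n) * norm (P j)"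
    by (rule norm_blinfun_compose)
  also have "\<dots> \<le> C * norm (P j)"
    by (intro mult_right_mono bound) simp
  finally show False
    using n \<open>P j \<noteq> 0\<close> by simp
qed

section \<open>Contour integrals, invariant subspaces and Riesz projections\<close>

text \<open>The resolvent is a finite sum of simple fractions times the \<open>P i\<close>. Each
  fraction integrates to a winding number, and summing over the contour leaves only the index
  \<open>j\<close>.\<close>

lemma resolution_cycle_integral:
  assumes spec: "op_spectrum T = lam ` {1..m}" and inj: "inj_on lam {1..m}" and j: "j \<in> {1..m}"
    and \<Gamma>: "separating_contour T {lam j} \<Gamma>"
  shows "has_vector_cycle_integral (op_resolvent T) ((2 * complex_of_real pi * \<i>) *\<^sub>C P j) \<Gamma>"
proof -
  define K where "K = (\<lambda>\<gamma>. \<Sum>i=1..m. (2 * pi * \<i> * winding_number \<gamma> (lam i)) *\<^sub>C P i)"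
  have "has_vector_contour_integral (op_resolvent T) (K \<gamma>) \<gamma>" if \<gamma>: "\<gamma> \<in> \<Gamma>" for \<gamma>
  proof -
    have val: "valid_path \<gamma>" and img: "path_image \<gamma> \<inter> lam ` {1..m} = {}"
      using \<Gamma> \<gamma> by (auto simp: separating_contour_def cauchy_contour_def spec)
    have "((\<lambda>t. (1 / (\<gamma> t - lam i) * vector_derivative \<gamma> (at t within {0..1})) *\<^sub>C P i)
        has_integral (2 * pi * \<i> * winding_number \<gamma> (lam i)) *\<^sub>C P i) {0..1}" if "i \<in> {1..m}" for i
    proof -
      have "((\<lambda>w. 1 / (w - lam i)) has_contour_integral 2 * pi * \<i> * winding_number \<gamma> (lam i)) \<gamma>"
        using val img that by (intro has_contour_integral_winding_number) auto
      \<comment> \<open>The scalar integral is transported to operators by the bounded linear map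
        that sends \<open>c\<close> to \<open>c *\<^sub>C P i\<close>.\<close>
      from has_integral_linear[OF this[unfolded has_contour_integral_def] bounded_linear_scaleC_left[of "P i"]]
      show ?thesis by (simp add: o_def)
    qed
    then have "((\<lambda>t. \<Sum>i=1..m. (1 / (\<gamma> t - lam i) * vector_derivative \<gamma> (at t within {0..1})) *\<^sub>C P i)
        has_integral K \<gamma>) {0..1}"
      unfolding K_def by (intro has_integral_sum) auto
    moreover have "(\<Sum>i=1..m. (1 / (\<gamma> t - lam i) * vector_derivative \<gamma> (at t within {0..1})) *\<^sub>C P i)
        = vector_derivative \<gamma> (at t within {0..1}) *\<^sub>C op_resolvent T (\<gamma> t)" if "t \<in> {0..1}" for t
    proof -
      have "\<gamma> t \<notin> lam ` {1..m}" using img that unfolding path_image_def by blast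
      then show ?thesis
        by (simp add: resolution_resolvent scaleC_sum_right scaleC_scaleC mult.commute)
    qed
    ultimately show ?thesis
      unfolding has_vector_contour_integral_def by (rule has_integral_eq[rotated])
  qed
  moreover have "(2 * complex_of_real pi * \<i>) *\<^sub>C P j = (\<Sum>\<gamma>\<in>\<Gamma>. K \<gamma>)"
  proof -
    have wind: "(\<Sum>\<gamma>\<in>\<Gamma>. winding_number \<gamma> (lam i)) = (if i = j then 1 else 0)" if "i \<in> {1..m}" for i
      using \<Gamma> that j inj_on_eq_iff[OF inj] by (auto simp: separating_contour_def spec)
    have "(\<Sum>\<gamma>\<in>\<Gamma>. K \<gamma>) = (\<Sum>i=1..m. (2 * pi * \<i> * (\<Sum>\<gamma>\<in>\<Gamma>. winding_number \<gamma> (lam i))) *\<^sub>C P i)"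
      unfolding K_def by (subst sum.swap) (simp add: scaleC_sum_left sum_distrib_left)
    also have "\<dots> = (\<Sum>i=1..m. if i = j then (2 * pi * \<i>) *\<^sub>C P j else 0)"
      by (intro sum.cong) (auto simp: wind)
    also have "\<dots> = (2 * pi * \<i>) *\<^sub>C P j" using j by simp
    finally show ?thesis by simp
  qed
  ultimately show ?thesis
    unfolding has_vector_cycle_integral_def by blast
qed

lemma resolution_invariant_direct_sum:
  assumes T: "T \<in> bounded_ops" and j: "j \<in> {1..m}"
  shows "invariant_subspace T (range (blinfun_apply (P j)))"
    and "invariant_subspace T (op_ker (P j))"
    and "is_direct_sum (range (blinfun_apply (P j))) (op_ker (P j))"
proof -
  note PB = resolution_projection(1)[OF j]
  have subspaceI: "module.subspace (*\<^sub>C) M"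
    if "0 \<in> M" "\<And>x y. x \<in> M \<Longrightarrow> y \<in> M \<Longrightarrow> x + y \<in> M" "\<And>c x. x \<in> M \<Longrightarrow> c *\<^sub>C x \<in> M" for M :: "'a set"
    using that vector_space_scaleC
    by (subst module.subspace_def) (auto simp: module_iff_vector_space)
  have PP: "blinfun_apply (P j) (blinfun_apply (P j) x) = blinfun_apply (P j) x" for x
    using resolution_projection(2)[OF j] by (metis blinfun_apply_blinfun_compose)
  have PT: "blinfun_apply (P j) (blinfun_apply T x) = lam j *\<^sub>C blinfun_apply (P j) x" for x
    using spectral_sum_compose_projection(2)[OF j, of lam] unfolding resolution_eq(1)[symmetric]
    by (metis blinfun_apply_blinfun_compose blinfun_apply_scaleC)
  \<comment> \<open>As an eigenspace, the range is visibly closed and invariant.\<close>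
  have range_eq: "range (blinfun_apply (P j)) = {x. blinfun_apply T x = lam j *\<^sub>C x}"
    using res j by (auto simp: spectral_resolution_def op_eigenspace_def)
  show "invariant_subspace T (range (blinfun_apply (P j)))"
    unfolding invariant_subspace_def range_eq
  proof (intro conjI subspaceI)
    show "closed {x. blinfun_apply T x = lam j *\<^sub>C x}"
      by (intro closed_Collect_eq continuous_intros linear_continuous_on[OF bounded_linear_scaleC])
  qed (use T in \<open>auto simp: blinfun.add_right scaleC_add_right bounded_ops_scaleC scaleC_scaleC mult.commute\<close>)
  show "invariant_subspace T (op_ker (P j))"
    unfolding invariant_subspace_def op_ker_def
  proof (intro conjI subspaceI)
    show "closed {x. blinfun_apply (P j) x = 0}"
      by (intro closed_Collect_eq continuous_intros)
  qed (use PB in \<open>auto simp: blinfun.add_right bounded_ops_scaleC PT\<close>)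
  show "is_direct_sum (range (blinfun_apply (P j))) (op_ker (P j))"
    unfolding is_direct_sum_def
  proof (intro conjI)
    have "x = blinfun_apply (P j) x + (x - blinfun_apply (P j) x)"
      "x - blinfun_apply (P j) x \<in> op_ker (P j)" for x
      by (auto simp: op_ker_def blinfun.diff_right PP)
    then show "{u + v | u v. u \<in> range (blinfun_apply (P j)) \<and> v \<in> op_ker (P j)} = UNIV"
      by blast
    show "range (blinfun_apply (P j)) \<inter> op_ker (P j) = {0}"
      by (auto simp: op_ker_def PP intro: rev_image_eqI[of 0])
  qed
qed

end

text \<open>A circle about \<open>a\<close> whose closed disc contains no spectral point other than
  possibly \<open>a\<close> itself.\<close>

lemma ex_separating_contour:
  assumes fin: "finite (op_spectrum T)"
  shows "\<exists>\<Gamma>. separating_contour T {a} \<Gamma>"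
proof -
  have "open (- (op_spectrum T - {a}))"
    using fin by (intro open_Compl finite_imp_closed) simp
  moreover have "a \<in> - (op_spectrum T - {a})" by simp
  ultimately obtain r where "r > 0" and r: "cball a r \<subseteq> - (op_spectrum T - {a})"
    unfolding open_contains_cball by blast
  have inside: "winding_number (circlepath a r) z = 1" if "dist a z < r" for z
    using that by (intro winding_number_circlepath) (simp add: dist_norm norm_minus_commute)
  have outside: "winding_number (circlepath a r) z = 0" if "dist a z > r" for z
    using that \<open>r > 0\<close> by (intro winding_number_zero_outside[where s = "cball a r"]) auto
  have "separating_contour T {a} {circlepath a r}"
    unfolding separating_contour_def cauchy_contour_def
  proof (intro conjI ballI allI impI)
    fix z
    assume "z \<notin> (\<Union>\<gamma>\<in>{circlepath a r}. path_image \<gamma>)"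
    then have "dist a z < r \<or> dist a z > r" using \<open>r > 0\<close> by auto
    then show "(\<Sum>\<gamma>\<in>{circlepath a r}. winding_number \<gamma> z) \<in> {0, 1}"
      using inside outside by auto
  next
    fix z
    assume "z \<in> op_spectrum T - {a}"
    with r have "dist a z > r" by force
    then show "(\<Sum>\<gamma>\<in>{circlepath a r}. winding_number \<gamma> z) = 0" using outside by simp
  qed (use \<open>r > 0\<close> r inside in \<open>auto simp: simple_path_circlepath\<close>)
  then show ?thesis by blast
qed

text \<open>Since \<open>is_riesz_projection\<close> determines its operator, this also carries the
  uniqueness of the resolution.\<close>

lemma spectral_resolution_riesz:
  assumes res: "spectral_resolution T m lam P" and spec: "op_spectrum T = lam ` {1..m}"
    and inj: "inj_on lam {1..m}" and j: "j \<in> {1..m}"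
  shows "is_riesz_projection T {lam j} (P j)"
proof -
  have fin: "finite (op_spectrum T)" using spec by simp
  show ?thesis
    unfolding is_riesz_projection_def
  proof (intro conjI allI impI)
    show "\<exists>\<Gamma>. separating_contour T {lam j} \<Gamma>" by (rule ex_separating_contour[OF fin])
    show "\<exists>J. has_vector_cycle_integral (op_resolvent T) J \<Gamma> \<and>
           P j = (1 / (2 * complex_of_real pi * \<i>)) *\<^sub>C J" if "separating_contour T {lam j} \<Gamma>" for \<Gamma>
      using resolution_cycle_integral[OF res spec inj j that]
      by (intro exI conjI) (auto simp: scaleC_scaleC scaleC_one)
  qed (use fin spec j in \<open>auto intro: finite_imp_closed\<close>)
qed

section \<open>Projections by Lagrange interpolation\<close>

text \<open>With the projections taken as polynomials in \<open>T\<close>, the algebraic clauses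
  become polynomial identities that need checking only at the nodes \<open>lam i\<close>.\<close>

lemma ex_spectral_resolution:
  assumes T: "T \<in> bounded_ops" and inj: "inj_on lam {1..m}"
    and ann: "op_poly T (\<Prod>x\<in>lam ` {1..m}. [:- x, 1:]) = 0"
  shows "\<exists>P. spectral_resolution T m lam P"
proof -
  \<comment> \<open>The Lagrange basis polynomials for the nodes \<open>lam i\<close>.\<close>
  define L where "L = (\<lambda>j. smult (inverse (\<Prod>i\<in>{1..m} - {j}. lam j - lam i)) (\<Prod>i\<in>{1..m} - {j}. [:- lam i, 1:]))"
  define P where "P = (\<lambda>j. op_poly T (L j))"
  have L: "poly (L j) (lam i) = (if i = j then 1 else 0)" if "i \<in> {1..m}" "j \<in> {1..m}" for i j
  proof (cases "i = j")
    case True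
    have "(\<Prod>i\<in>{1..m} - {j}. lam j - lam i) \<noteq> 0"
      using inj that by (auto dest: inj_onD)
    then show ?thesis using True by (simp add: L_def poly_prod)
  next
    case False
    then have "(\<Prod>k\<in>{1..m} - {j}. lam i - lam k) = 0"
      using that by (intro prod_zero) auto
    then show ?thesis using False by (simp add: L_def poly_prod)
  qed
  \<comment> \<open>Polynomials agreeing at all nodes differ by a multiple of the annihilating
    product.\<close>
  have eqI: "op_poly T p = op_poly T q" if "\<And>i. i \<in> {1..m} \<Longrightarrow> poly p (lam i) = poly q (lam i)" for p q
  proof -
    have "(\<Prod>x\<in>lam ` {1..m}. [:- x, 1:]) dvd p - q"
      using that by (intro prod_linear_dvd) auto
    then obtain r where "p - q = (\<Prod>x\<in>lam ` {1..m}. [:- x, 1:]) * r" by (auto elim: dvdE)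
    then have "op_poly T (p - q) = 0"
      by (simp only: op_poly_mult[OF T] ann blinfun_compose_zero)
    then show ?thesis by (simp add: op_poly_diff[OF T])
  qed
  have X: "op_poly T [:0, 1:] = T" by (simp add: scaleC_one)
  have "spectral_resolution T m lam P"
    unfolding spectral_resolution_def
  proof (intro conjI ballI impI)
    fix j assume j: "j \<in> {1..m}"
    have "op_poly T (L j * L j) = op_poly T (L j)"
      by (rule eqI) (use j L in auto)
    then show "is_projection (P j)"
      using T by (simp add: is_projection_def P_def op_poly_in_bounded_ops op_poly_mult)
    \<comment> \<open>At the node \<open>lam j\<close> both sides equal \<open>lam j\<close>, and at
      all others both vanish; so \<open>P j\<close> maps into the eigenspace.\<close>
    have "op_poly T ([:0, 1:] * L j) = op_poly T (smult (lam j) (L j))"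
      by (rule eqI) (use j L in \<open>auto simp del: mult_pCons_left\<close>)
    then have TP: "T o\<^sub>L P j = lam j *\<^sub>C P j"
      unfolding op_poly_mult[OF T] X op_poly_smult[OF T] by (simp add: P_def)
    show "range (blinfun_apply (P j)) = op_eigenspace T (lam j)"
    proof (intro equalityI subsetI)
      fix x assume "x \<in> op_eigenspace T (lam j)"
      \<comment> \<open>On an eigenvector for \<open>lam j\<close> a polynomial in \<open>T\<close>
        acts as its value at \<open>lam j\<close>, and \<open>L j\<close> is 1 there.\<close>
      then have "blinfun_apply (P j) x = x"
        using op_poly_eigenvector[OF T, of x "lam j" "L j"] L[OF j j]
        by (simp add: op_eigenspace_def P_def scaleC_one)
      then show "x \<in> range (blinfun_apply (P j))" by (metis rangeI)
    next
      fix x assume "x \<in> range (blinfun_apply (P j))"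
      then show "x \<in> op_eigenspace T (lam j)"
        using arg_cong[OF TP, of blinfun_apply] by (auto simp: op_eigenspace_def fun_eq_iff)
    qed
    fix i assume i: "i \<in> {1..m}"
    show "P j o\<^sub>L P i = 0" if "j \<noteq> i"
    proof -
      have "op_poly T (L j * L i) = op_poly T 0"
        by (rule eqI) (use i j L that in auto)
      then show ?thesis by (simp add: P_def op_poly_mult[OF T])
    qed
  next
    have "op_poly T [:0, 1:] = op_poly T (\<Sum>j=1..m. smult (lam j) (L j))"
      by (rule eqI) (simp add: poly_sum L if_distrib cong: if_cong)
    then show "T = (\<Sum>j=1..m. lam j *\<^sub>C P j)"
      unfolding X by (simp add: op_poly_sum op_poly_smult[OF T] P_def)
    have "op_poly T 1 = op_poly T (\<Sum>j=1..m. L j)"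
      by (rule eqI) (simp add: poly_sum L)
    then show "id_blinfun = (\<Sum>j=1..m. P j)"
      by (simp add: op_poly_sum P_def)
  qed
  then show ?thesis by blast
qed

section \<open>Bounded integer powers and the equivalence\<close>

lemma bdd_above_op_power_int_iff:
  "bdd_above (range (\<lambda>n::int. norm (op_power_int T n))) \<longleftrightarrow>
    (\<exists>C. \<forall>n. norm (op_power T n) \<le> C \<and> norm (op_power (op_inverse T) n) \<le> C)"
proof
  assume "bdd_above (range (\<lambda>n::int. norm (op_power_int T n)))"
  then obtain C where C: "\<And>n. norm (op_power_int T n) \<le> C"
    unfolding bdd_above_def by auto
  \<comment> \<open>At \<open>n = 0\<close> the index \<open>- int n\<close> falls into the
    nonnegative branch; both powers are the identity there.\<close>
  have "norm (op_power T n) \<le> C \<and> norm (op_power (op_inverse T) n) \<le> C" for n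
    using C[of "int n"] C[of "- int n"] C[of 0] by (cases "n = 0") (auto simp: op_power_int_def)
  then show "\<exists>C. \<forall>n. norm (op_power T n) \<le> C \<and> norm (op_power (op_inverse T) n) \<le> C"
    by blast
next
  assume "\<exists>C. \<forall>n. norm (op_power T n) \<le> C \<and> norm (op_power (op_inverse T) n) \<le> C"
  then obtain C where "\<And>n. norm (op_power T n) \<le> C" "\<And>n. norm (op_power (op_inverse T) n) \<le> C"
    by blast
  then show "bdd_above (range (\<lambda>n::int. norm (op_power_int T n)))"
    by (intro bdd_aboveI2[where M = C]) (simp add: op_power_int_def)
qed

theorem corollary3p3:
  fixes T :: "'a::complex_banach \<Rightarrow>\<^sub>L 'a"
    and m :: nat
    and lam :: "nat \<Rightarrow> complex"
  assumes "T \<in> bounded_ops"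
    and "op_invertible T"
    and "inj_on lam {1..m}"
    and "op_spectrum T = lam ` {1..m}"
  shows "(bdd_above (range (\<lambda>n::int. norm (op_power_int T n))) \<longleftrightarrow>
            (\<forall>j\<in>{1..m}. cmod (lam j) = 1) \<and> (\<exists>P. spectral_resolution T m lam P))
       \<and> (bdd_above (range (\<lambda>n::int. norm (op_power_int T n))) \<longrightarrow>
            (\<forall>P. spectral_resolution T m lam P \<longrightarrow>
              (\<forall>j\<in>{1..m}.
                 is_riesz_projection T {lam j} (P j) \<and>
                 invariant_subspace T (range (blinfun_apply (P j))) \<and>
                 invariant_subspace T (op_ker (P j)) \<and>
                 is_direct_sum (range (blinfun_apply (P j))) (op_ker (P j)))))"
proof (intro conjI iffI impI)
  note T = assms(1) and inj = assms(3) and spec = assms(4)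
  have inv: "op_inverse_rel T (op_inverse T)"
    using assms(2) by (rule op_inverse_rel_op_inverse)
  {
    assume "bdd_above (range (\<lambda>n::int. norm (op_power_int T n)))"
    then obtain C where C: "\<And>n. norm (op_power T n) \<le> C" "\<And>n. norm (op_power (op_inverse T) n) \<le> C"
      unfolding bdd_above_op_power_int_iff by blast
    have "op_poly T (\<Prod>x\<in>op_spectrum T. [:- x, 1:]) = 0"
      using T inv C spec by (intro power_bounded_finite_spectrum_annihilated) auto
    with T inj spec show ex: "\<exists>P. spectral_resolution T m lam P"
      by (intro ex_spectral_resolution) auto
    then obtain P where res: "spectral_resolution T m lam P" by blast
    have nz: "P j \<noteq> 0" if "j \<in> {1..m}" for j
      using resolution_spectrum_nonzero[OF res inj that] spec that by blast
    \<comment> \<open>A zero eigenvalue would give T P_j = 0, hence P_j = 0 after multiplying by the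
      inverse of T.\<close>
    have lam0: "lam j \<noteq> 0" if j: "j \<in> {1..m}" for j
    proof
      assume "lam j = 0"
      then have "T o\<^sub>L P j = 0"
        using spectral_sum_compose_projection(1)[OF res j, of lam] resolution_eq(1)[OF res] by simp
      then have "(op_inverse T o\<^sub>L T) o\<^sub>L P j = 0" by (simp add: blinfun_compose_assoc)
      with inv nz[OF j] show False by (simp add: op_inverse_rel_def)
    qed
    have S: "op_inverse T = spectral_sum m P (\<lambda>j. inverse (lam j))"
      by (rule op_inverse_eqI, subst resolution_eq(1)[OF res], rule spectral_sum_inverse[OF res])
        (use lam0 in blast)
    show "\<forall>j\<in>{1..m}. cmod (lam j) = 1"
    proof
      fix j assume j: "j \<in> {1..m}"
      \<comment> \<open>Bounded positive powers put \<open>lam j\<close> in the closed unit disc;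
        bounded negative powers do the same for its inverse.\<close>
      have "cmod (lam j) \<le> 1"
        using power_bounded_spectral_sum[OF res _ j nz[OF j], of lam] C(1) resolution_eq(1)[OF res] by metis
      moreover have "cmod (inverse (lam j)) \<le> 1"
        using power_bounded_spectral_sum[OF res _ j nz[OF j], of "\<lambda>j. inverse (lam j)"] C(2) S by metis
      ultimately show "cmod (lam j) = 1"
        using lam0[OF j] by (simp add: norm_inverse inverse_le_1_iff)
    qed
  next
    assume "(\<forall>j\<in>{1..m}. cmod (lam j) = 1) \<and> (\<exists>P. spectral_resolution T m lam P)"
    then obtain P where lam1: "\<And>j. j \<in> {1..m} \<Longrightarrow> cmod (lam j) = 1" and res: "spectral_resolution T m lam P"
      by blast
    have S: "op_inverse T = spectral_sum m P (\<lambda>j. inverse (lam j))"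
      by (rule op_inverse_eqI, subst resolution_eq(1)[OF res], rule spectral_sum_inverse[OF res])
        (use lam1 in force)
    \<comment> \<open>Powers of unimodular coefficients stay unimodular, so the sum of the norms of
      the projections bounds every power.\<close>
    have "norm (op_power T n) \<le> (\<Sum>j=1..m. norm (P j))" for n
      by (subst resolution_eq(1)[OF res], subst op_power_spectral_sum[OF res], rule norm_spectral_sum_le)
        (simp add: lam1 norm_power)
    moreover have "norm (op_power (op_inverse T) n) \<le> (\<Sum>j=1..m. norm (P j))" for n
      unfolding S op_power_spectral_sum[OF res]
      by (rule norm_spectral_sum_le) (simp add: lam1 norm_power norm_inverse)
    ultimately show "bdd_above (range (\<lambda>n::int. norm (op_power_int T n)))"
      unfolding bdd_above_op_power_int_iff by blast
  next
    show "\<forall>P. spectral_resolution T m lam P \<longrightarrow>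
              (\<forall>j\<in>{1..m}.
                 is_riesz_projection T {lam j} (P j) \<and>
                 invariant_subspace T (range (blinfun_apply (P j))) \<and>
                 invariant_subspace T (op_ker (P j)) \<and>
                 is_direct_sum (range (blinfun_apply (P j))) (op_ker (P j)))"
      using spectral_resolution_riesz[OF _ spec inj] resolution_invariant_direct_sum[OF _ T] by blast
  }
qed

end
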